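(* Let $(\mathbb{B},\|\cdot\|)$ be a separable $\beta$-smooth Banach space and let $(X_n)_{n\ge1}$ be $\mathbb{B}$-valued random variables adapted to a filtration $(\mathcal{F}_n)_{n\ge0}$ such that $\mathbb{E}(X_n\mid\mathcal{F}_{n-1})=\mu$ for all $n\ge1$ (some unknown $\mu\in\mathbb{B}$) and $\sup_{n\ge1}\mathbb{E}(\|X_n\|^p\mid\mathcal{F}_{n-1})\le v<\infty$ for known $p\in(1,2]$ and $v>0$. For $\lambda>0$ let $\widehat{\mu}_n(0,\lambda,0):=\frac1n\sum_{m\le n}\mathtt{Trunc}(\lambda X_m)X_m$. Fix $\delta\in(0,1]$. Then for any $\lambda>0$, with probability at least $1-\delta$, simultaneously for all $n\ge1$, \[ \|\widehat{\mu}_n(0,\lambda,0)-\mu\|\le2v\lambda^{p-1}\big(\beta\mathfrak{C}_p(\mathbb{B})+K_p2^{p-1}\big)+\frac{\beta\log(2/\delta)}{\lambda n}. \] Moreover, for a fixed sample size $n$, if \[ \lambda=\left(\frac{\log(2/\delta)\beta}{2nv(\beta\mathfrak{C}_p(\mathbb{B})+K_p2^{p-1})}\right)^{1/p}, \] then with probability at least $1-\delta$, \[ \|\widehat{\mu}_n(0,\lambda,0)-\mu\|\le2\big(2v(\beta\mathfrak{C}_p(\mathbb{B})+K_p2^{p-1})\big)^{1/p}\left(\beta\frac{\log(2/\delta)}{n}\right)^{(p-1)/p}. \]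
   Context: $\beta$-smooth: the norm $f=\|\cdot\|$ satisfies $f(0)=0$, $|f(x+y)-f(x)|\le\|y\|$ and $f^2(x+y)+f^2(x-y)\le2f^2(x)+2\beta^2\|y\|^2$ for all $x,y$. $\mathtt{Trunc}(x):=\min\{1,1/\|x\|\}$ ($\mathtt{Trunc}(0)=1$). $K_p:=\frac1p\left(\frac{p-1}{p}\right)^{p-1}$. $\mathfrak{C}_p(\mathbb{B}):=2^{p-1}\frac{e^{2/\beta}-2/\beta-1}{(2/\beta)^2}$ if $\mathbb{B}$ is a Hilbert space and $\mathfrak{C}_p(\mathbb{B}):=2^{p+1}\frac{e^{2/\beta}-2/\beta-1}{(2/\beta)^2}$ otherwise. *)

theory Defs
  imports "HOL-Probability.Probability"
begin

definition beta_smooth :: "real \<Rightarrow> 'b::real_normed_vector itself \<Rightarrow> bool" where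
  "beta_smooth \<beta> (_ :: 'b itself) \<longleftrightarrow>
     norm (0::'b) = 0 \<and>
     (\<forall>x y :: 'b. \<bar>norm (x + y) - norm x\<bar> \<le> norm y) \<and>
     (\<forall>x y :: 'b. (norm (x + y))\<^sup>2 + (norm (x - y))\<^sup>2 \<le> 2 * (norm x)\<^sup>2 + 2 * \<beta>\<^sup>2 * (norm y)\<^sup>2)"

definition is_hilbert :: "'b::real_normed_vector itself \<Rightarrow> bool" where
  "is_hilbert (_ :: 'b itself) \<longleftrightarrow>
     (\<exists>ip :: 'b \<Rightarrow> 'b \<Rightarrow> real.
        (\<forall>x y z. ip (x + y) z = ip x z + ip y z) \<and>
        (\<forall>c x y. ip (c *\<^sub>R x) y = c * ip x y) \<and>
        (\<forall>x y. ip x y = ip y x) \<and>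
        (\<forall>x. ip x x = (norm x)\<^sup>2))"

definition Trunc :: "'b::real_normed_vector \<Rightarrow> real" where
  "Trunc x = (if x = 0 then 1 else min 1 (1 / norm x))"

definition K_const :: "real \<Rightarrow> real" where
  "K_const p = (1 / p) * ((p - 1) / p) powr (p - 1)"

definition C_const :: "real \<Rightarrow> real \<Rightarrow> 'b::real_normed_vector itself \<Rightarrow> real" where
  "C_const p \<beta> B =
     (if is_hilbert B then 2 powr (p - 1) else 2 powr (p + 1)) *
     ((exp (2 / \<beta>) - 2 / \<beta> - 1) / (2 / \<beta>)\<^sup>2)"

definition mu_hat :: "(nat \<Rightarrow> 'a \<Rightarrow> 'b::real_normed_vector) \<Rightarrow> real \<Rightarrow> nat \<Rightarrow> 'a \<Rightarrow> 'b" where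
  "mu_hat X lam n \<omega> = (1 / real n) *\<^sub>R (\<Sum>m = 1..n. Trunc (lam *\<^sub>R X m \<omega>) *\<^sub>R X m \<omega>)"

text \<open>E(Y | G) = mu (a constant, hence G-measurable), via the defining property of
  conditional expectation: Y integrable and its integral over every G-set A equals P(A) mu.\<close>
definition cond_exp_is_const :: "'a measure \<Rightarrow> 'a measure \<Rightarrow> ('a \<Rightarrow> 'b::{banach, second_countable_topology}) \<Rightarrow> 'b \<Rightarrow> bool" where
  "cond_exp_is_const M G Y \<mu> \<longleftrightarrow>
     integrable M Y \<and>
     (\<forall>A \<in> sets G. (LINT \<omega>:A|M. Y \<omega>) = measure M A *\<^sub>R \<mu>)"

end

theory Submission
  imports Defs
begin

text \<open>
  Smoothness bounds the second differences of \<open>H = cosh (norm _)\<close> by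
  \<open>\<beta>\<^sup>2 (norm y)\<^sup>2 cosh (norm x + norm y)\<close>. Hence the one-sided directional derivative of the convex
  function \<open>H\<close> is a bounded linear functional \<open>H' x\<close>, and
  \<open>H (x + d) \<le> H x + H' x d + \<beta>\<^sup>2 H x (exp (norm d) - 1 - norm d)\<close>, as in Pinelis' martingale
  inequality. With \<open>d = (lam / \<beta>) (Trunc (lam X) X - \<mu>)\<close> the conditional mean of the linear term is at
  most \<open>H x\<close> times the truncation bias and the remainder is controlled by the conditional second
  moment of the truncated variable, so \<open>H\<close> of the partial sums, divided by a geometric factor, is a
  nonnegative supermartingale; Ville's inequality and \<open>cosh t \<ge> exp t / 2\<close> give the
  time-uniform bound. This needs \<open>lam powr p * v \<le> 1\<close>; otherwise the right-hand side
  exceeds \<open>1 / lam + norm \<mu>\<close> (or the space is trivial) and the bound holds surely.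
\<close>

section \<open>Second-order expansion of the hyperbolic cosine of a smooth norm\<close>

text \<open>The norm is not assumed differentiable: \<open>beta_smooth\<close> only compares squared
  norms at x + y and x - y. Hence difference quotients take the place of derivatives, and a sum of
  second differences along a segment takes the place of Taylor's formula. The potential is cosh
  because cosh is even: as a function of t^2 it has no kink at t = 0, so a bound on squared norms
  passes through it. The price is the factor 1/2 in cosh t \<ge> exp t / 2, which is the 2 in ln (2
  / \<delta>). The scale lam / \<beta> is chosen so that the \<beta>^2 of the expansion cancels
  against the squared increment. Increments then have norm at most 2 / \<beta>, which is where the
  argument of the exponential in \<open>C_const\<close> comes from. The hypothesis on the
  conditional mean speaks only of integrals over sets of the past. Each conditional estimate is
  therefore an inequality between integrals over all such sets, proved first for a deterministic
  position x and then carried over to the random partial sum by simple functions.\<close>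

lemma sinh_le_mult_cosh:
  fixes z :: real
  assumes "0 \<le> z"
  shows "sinh z \<le> z * cosh z"
proof -
  have "0 * cosh 0 - sinh 0 \<le> z * cosh z - sinh z"
  proof (rule DERIV_nonneg_imp_nondecreasing[OF assms])
    fix t :: real assume "0 \<le> t" "t \<le> z"
    then show "\<exists>y. ((\<lambda>t. t * cosh t - sinh t) has_real_derivative y) (at t) \<and> 0 \<le> y"
      by (intro exI[of _ "t * sinh t"]) (auto intro!: derivative_eq_intros)
  qed
  then show ?thesis by simp
qed

text \<open>In the variable t^2 / 2 the slope of cosh is sinh t / t, which is at most cosh t and so
  at most cosh m. Squares are the quantities that \<open>beta_smooth\<close> controls.\<close>

lemma cosh_diff_le:
  fixes c m :: real
  assumes "0 \<le> c" "c \<le> m"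
  shows "cosh m - cosh c \<le> (m\<^sup>2 - c\<^sup>2) / 2 * cosh m"
proof -
  have "c\<^sup>2 / 2 * cosh m - cosh c \<le> m\<^sup>2 / 2 * cosh m - cosh m"
  proof (rule DERIV_nonneg_imp_nondecreasing[OF assms(2)])
    fix t :: real assume t: "c \<le> t" "t \<le> m"
    have "sinh t \<le> t * cosh t" using sinh_le_mult_cosh assms t by simp
    also have "\<dots> \<le> t * cosh m"
      using assms t by (intro mult_left_mono) (auto simp: cosh_real_nonneg_le_iff)
    finally show "\<exists>y. ((\<lambda>t. t\<^sup>2 / 2 * cosh m - cosh t) has_real_derivative y) (at t) \<and> 0 \<le> y"
      by (intro exI[of _ "t * cosh m - sinh t"]) (auto intro!: derivative_eq_intros)
  qed
  then show ?thesis by (simp add: field_simps)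
qed

text \<open>Meant for norms m + e and m - e of x + y and x - y: the left side is half a second
  difference of cosh, and the hypothesis on squares is the smoothness inequality in the coordinates
  m, e. Each factor is compared through its square, so the excess m^2 + e^2 - c^2 appears.\<close>

lemma cosh_mult_cosh_diff_le:
  fixes c m e q :: real
  assumes "0 \<le> c" "c \<le> m" "m\<^sup>2 + e\<^sup>2 \<le> c\<^sup>2 + q"
  shows "cosh m * cosh e - cosh c \<le> q / 2 * (cosh m * cosh e)"
proof -
  have e: "cosh e - 1 \<le> e\<^sup>2 / 2 * cosh e"
    using cosh_diff_le[of 0 "\<bar>e\<bar>"] by simp
  have "cosh m * cosh e - cosh c = cosh m * (cosh e - 1) + (cosh m - cosh c)"
    by (simp add: algebra_simps)
  also have "\<dots> \<le> cosh m * (e\<^sup>2 / 2 * cosh e) + (m\<^sup>2 - c\<^sup>2) / 2 * cosh m"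
    using e cosh_diff_le[OF assms(1,2)] by (intro add_mono mult_left_mono) auto
  also have "(m\<^sup>2 - c\<^sup>2) / 2 * cosh m \<le> (m\<^sup>2 - c\<^sup>2) / 2 * (cosh m * cosh e)"
    using assms(1,2) cosh_real_ge_1[of e]
    by (intro mult_left_mono) (auto simp: power_mono)
  also have "cosh m * (e\<^sup>2 / 2 * cosh e) + (m\<^sup>2 - c\<^sup>2) / 2 * (cosh m * cosh e)
      = (m\<^sup>2 + e\<^sup>2 - c\<^sup>2) / 2 * (cosh m * cosh e)"
    by (simp add: field_simps)
  also have "\<dots> \<le> q / 2 * (cosh m * cosh e)"
    using assms(3) by (intro mult_right_mono) auto
  finally show ?thesis by simp
qed

lemma cosh_mono_nonneg: "0 \<le> x \<Longrightarrow> x \<le> y \<Longrightarrow> cosh x \<le> cosh (y::real)"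
  by (simp add: cosh_real_nonneg_le_iff)

lemma cosh_add_le_exp:
  fixes c s :: real
  assumes "0 \<le> s"
  shows "cosh (c + s) \<le> cosh c * exp s"
proof -
  have "exp (- c - s) \<le> exp (s - c)" using assms by simp
  then show ?thesis
    by (simp add: cosh_field_def field_simps flip: exp_add)
qed

text \<open>Mean m and half difference e of the two norms turn the sum of the two cosh into 2 cosh m
  cosh e and the sum of the two squares into 2 (m^2 + e^2). The triangle inequality supplies norm x
  \<le> m, without which the squares could not be compared.\<close>

lemma cosh_norm_second_difference:
  fixes x y :: "'b::real_normed_vector"
  assumes smooth: "beta_smooth \<beta> TYPE('b)"
  shows "cosh (norm (x + y)) + cosh (norm (x - y)) - 2 * cosh (norm x)
      \<le> \<beta>\<^sup>2 * (norm y)\<^sup>2 * cosh (norm x + norm y)"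
proof -
  define a b where "a = norm (x + y)" and "b = norm (x - y)"
  define m e where "m = (a + b) / 2" and "e = (a - b) / 2"
  have ab: "a = m + e" "b = m - e" by (auto simp: m_def e_def field_simps)
  have "norm ((x + y) + (x - y)) \<le> a + b"
    unfolding a_def b_def by (rule norm_triangle_ineq)
  moreover have "(x + y) + (x - y) = 2 *\<^sub>R x" by (simp add: scaleR_2)
  ultimately have m: "norm x \<le> m" by (simp add: m_def)
  have "a\<^sup>2 + b\<^sup>2 \<le> 2 * (norm x)\<^sup>2 + 2 * \<beta>\<^sup>2 * (norm y)\<^sup>2"
    using smooth by (auto simp: beta_smooth_def a_def b_def)
  then have sq: "m\<^sup>2 + e\<^sup>2 \<le> (norm x)\<^sup>2 + \<beta>\<^sup>2 * (norm y)\<^sup>2"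
    by (simp add: ab power2_eq_square algebra_simps)
  have sum: "cosh a + cosh b = 2 * (cosh m * cosh e)"
    by (simp add: ab cosh_add cosh_diff)
  have "cosh a \<le> cosh (norm x + norm y)" "cosh b \<le> cosh (norm x + norm y)"
    by (auto simp: a_def b_def intro!: cosh_mono_nonneg norm_triangle_ineq norm_triangle_ineq4)
  then have le: "cosh m * cosh e \<le> cosh (norm x + norm y)" using sum by simp
  have "cosh a + cosh b - 2 * cosh (norm x)
      \<le> \<beta>\<^sup>2 * (norm y)\<^sup>2 * (cosh m * cosh e)"
    using cosh_mult_cosh_diff_le[OF norm_ge_zero m sq] sum by simp
  also have "\<dots> \<le> \<beta>\<^sup>2 * (norm y)\<^sup>2 * cosh (norm x + norm y)"
    using le by (intro mult_left_mono) auto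
  finally show ?thesis by (simp add: a_def b_def)
qed

lemma convex_on_cosh: "convex_on UNIV (cosh :: real \<Rightarrow> real)"
proof (rule convex_onI)
  fix t x y :: real assume t: "0 < t" "t < 1"
  have 1: "exp ((1 - t) * x + t * y) \<le> (1 - t) * exp x + t * exp y" 
    using convex_onD[OF exp_convex, of t x y] t by simp
  have 2: "exp ((1 - t) * (-x) + t * (-y)) \<le> (1 - t) * exp (-x) + t * exp (-y)" 
    using convex_onD[OF exp_convex, of t "-x" "-y"] t by simp
  have 3: "- ((1 - t) * x + t * y) = (1 - t) * (-x) + t * (-y)" by (simp add: algebra_simps)
  have "cosh ((1 - t) * x + t * y) \<le>
      ((1 - t) * exp x + t * exp y + ((1 - t) * exp (-x) + t * exp (-y))) / 2"
    unfolding cosh_field_def 3 using 1 2 by (intro divide_right_mono) auto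
  also have "\<dots> = (1 - t) * cosh x + t * cosh y"
    by (simp add: cosh_field_def field_simps)
  finally show "cosh ((1 - t) *\<^sub>R x + t *\<^sub>R y) \<le> (1 - t) * cosh x + t * cosh y" by simp
qed simp

lemma cosh_norm_convex:
  fixes x y :: "'b::real_normed_vector"
  assumes "0 \<le> u" "0 \<le> w" "u + w = 1"
  shows "cosh (norm (u *\<^sub>R x + w *\<^sub>R y)) \<le> u * cosh (norm x) + w * cosh (norm y)"
proof -
  have "norm (u *\<^sub>R x + w *\<^sub>R y) \<le> u * norm x + w * norm y"
    using norm_triangle_ineq[of "u *\<^sub>R x" "w *\<^sub>R y"] assms by simp
  then have "cosh (norm (u *\<^sub>R x + w *\<^sub>R y)) \<le> cosh (u * norm x + w * norm y)"
    by (intro cosh_mono_nonneg) auto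
  also have "\<dots> \<le> u * cosh (norm x) + w * cosh (norm y)"
    using convex_onD[OF convex_on_cosh, of w "norm x" "norm y"] assms by (simp add: eq_diff_eq[symmetric])
  finally show ?thesis .
qed

section \<open>The directional derivative of cosh of the norm\<close>

definition cosh_quot :: "'b::real_normed_vector \<Rightarrow> 'b \<Rightarrow> real \<Rightarrow> real" where
  "cosh_quot x d t = (cosh (norm (x + t *\<^sub>R d)) - cosh (norm x)) / t"

text \<open>By convexity the quotient is nondecreasing in t, so this infimum is the right derivative
  at 0. Taking the infimum avoids a separate proof that the limit exists.\<close>

definition cosh_gateaux :: "'b::real_normed_vector \<Rightarrow> 'b \<Rightarrow> real" where
  "cosh_gateaux x d = (INF t\<in>{0<..}. cosh_quot x d t)"

text \<open>With s = t u / (t + u), the point x + s (d + e) is the convex combination of x + t d and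
  x + u e with weights u / (t + u) and t / (t + u). Keeping t and u independent lets the two infima
  be taken one after the other.\<close>

lemma cosh_quot_subadditive:
  assumes t: "0 < t" "0 < u"
  shows "cosh_quot x (d + e) (t * u / (t + u)) \<le> cosh_quot x d t + cosh_quot x e u"
proof -
  define s where "s = t * u / (t + u)"
  have s: "s > 0" using t by (simp add: s_def)
  have split: "x + s *\<^sub>R (d + e) = (u / (t + u)) *\<^sub>R (x + t *\<^sub>R d) + (t / (t + u)) *\<^sub>R (x + u *\<^sub>R e)"
  proof -
    have "(u / (t + u)) *\<^sub>R x + (t / (t + u)) *\<^sub>R x = x"
      using t by (simp add: add.commute flip: scaleR_add_left add_divide_distrib)
    then show ?thesis 
      by (simp add: s_def algebra_simps)
  qed
  have "cosh (norm (x + s *\<^sub>R (d + e)))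
      \<le> u / (t + u) * cosh (norm (x + t *\<^sub>R d)) + t / (t + u) * cosh (norm (x + u *\<^sub>R e))"
    unfolding split using t by (intro cosh_norm_convex) (auto simp: add_divide_distrib[symmetric])
  moreover have "u / (t + u) * cosh (norm x) + t / (t + u) * cosh (norm x) = cosh (norm x)"
    using t by (simp add: add.commute flip: distrib_right add_divide_distrib)
  ultimately have "cosh (norm (x + s *\<^sub>R (d + e))) - cosh (norm x)
      \<le> u / (t + u) * (cosh (norm (x + t *\<^sub>R d)) - cosh (norm x))
        + t / (t + u) * (cosh (norm (x + u *\<^sub>R e)) - cosh (norm x))"
    unfolding right_diff_distrib by linarith
  also have "\<dots> = s * (cosh_quot x d t + cosh_quot x e u)"
  proof -
    have "s / t = u / (t + u)" "s / u = t / (t + u)"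
      using t by (auto simp: s_def)
    moreover have "s * (a / t + b / u) = s / t * a + s / u * b" for a b
      by (simp add: distrib_left)
    ultimately show ?thesis by (simp only: cosh_quot_def)
  qed
  finally have "cosh_quot x (d + e) s \<le> cosh_quot x d t + cosh_quot x e u"
    using s by (simp add: cosh_quot_def[of _ _ s] divide_le_eq mult.commute)
  then show ?thesis by (simp add: s_def)
qed

lemma cosh_quot_zero [simp]: "cosh_quot x 0 t = 0"
  by (simp add: cosh_quot_def)

text \<open>Subadditivity along d and -d, where the combined quotient is 0, bounds every forward
  quotient below by one backward quotient.\<close>

lemma cosh_quot_bdd_below: "bdd_below (cosh_quot x d ` {0<..})"
proof (rule bdd_belowI2[of _ "- cosh_quot x (- d) 1"])
  fix t :: real assume "t \<in> {0<..}"
  then show "- cosh_quot x (- d) 1 \<le> cosh_quot x d t"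
    using cosh_quot_subadditive[of t 1 x d "- d"] by simp
qed

lemma cosh_gateaux_le: "0 < t \<Longrightarrow> cosh_gateaux x d \<le> cosh_quot x d t"
  unfolding cosh_gateaux_def by (intro cINF_lower cosh_quot_bdd_below) auto

lemma cosh_gateaux_ge: "(\<And>t. 0 < t \<Longrightarrow> b \<le> cosh_quot x d t) \<Longrightarrow> b \<le> cosh_gateaux x d"
  unfolding cosh_gateaux_def by (intro cINF_greatest) auto

lemma cosh_gateaux_subadditive:
  "cosh_gateaux x (d + e) \<le> cosh_gateaux x d + cosh_gateaux x e"
proof -
  have *: "cosh_gateaux x (d + e) \<le> cosh_quot x d t + cosh_quot x e u" if "0 < t" "0 < u" for t u
    using cosh_gateaux_le[of "t * u / (t + u)" x "d + e"] cosh_quot_subadditive[OF that, of x d e] that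
    by simp
  have "cosh_gateaux x (d + e) - cosh_quot x d t \<le> cosh_gateaux x e" if "0 < t" for t
    by (rule cosh_gateaux_ge) (use *[OF that] in force)
  then have "cosh_gateaux x (d + e) - cosh_gateaux x e \<le> cosh_gateaux x d"
    by (intro cosh_gateaux_ge) force
  then show ?thesis by simp
qed

lemma cosh_gateaux_zero [simp]: "cosh_gateaux x 0 = 0"
  by (simp add: cosh_gateaux_def)

lemma cosh_gateaux_scaleR_pos:
  assumes "0 < c"
  shows "cosh_gateaux x (c *\<^sub>R d) = c * cosh_gateaux x d"
proof (rule antisym)
  have quot: "cosh_quot x (c *\<^sub>R d) t = c * cosh_quot x d (t * c)" for t
    using assms by (simp add: cosh_quot_def mult.commute)
  have "cosh_gateaux x (c *\<^sub>R d) / c \<le> cosh_gateaux x d"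
  proof (rule cosh_gateaux_ge)
    fix t :: real assume "0 < t"
    then show "cosh_gateaux x (c *\<^sub>R d) / c \<le> cosh_quot x d t"
      using cosh_gateaux_le[of "t / c" x "c *\<^sub>R d"] assms by (simp add: quot divide_le_eq mult.commute)
  qed
  then show "cosh_gateaux x (c *\<^sub>R d) \<le> c * cosh_gateaux x d"
    using assms by (simp add: divide_le_eq mult.commute)
  show "c * cosh_gateaux x d \<le> cosh_gateaux x (c *\<^sub>R d)"
    using assms by (intro cosh_gateaux_ge) (auto simp: quot intro!: mult_left_mono cosh_gateaux_le)
qed

text \<open>The quotient at t satisfies the bound up to a factor exp (t * norm d), which disappears
  as t tends to 0.\<close>

lemma cosh_gateaux_le_norm: "cosh_gateaux x d \<le> norm d * cosh (norm x)"
proof -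
  have "cosh_gateaux x d \<le> norm d * cosh (norm x) * exp (t * norm d)" if t: "0 < t" for t
  proof -
    have "cosh (norm (x + t *\<^sub>R d)) \<le> cosh (norm x + t * norm d)"
      using norm_triangle_ineq[of x "t *\<^sub>R d"] t by (intro cosh_mono_nonneg) auto
    also have "\<dots> \<le> cosh (norm x) * exp (t * norm d)"
      using t by (intro cosh_add_le_exp) auto
    finally have "cosh (norm (x + t *\<^sub>R d)) - cosh (norm x) \<le> cosh (norm x) * (exp (t * norm d) - 1)"
      by (simp add: algebra_simps)
    also have "exp (t * norm d) - 1 \<le> t * norm d * exp (t * norm d)"
    proof -
      have "(1 - t * norm d) * exp (t * norm d) \<le> exp (- (t * norm d)) * exp (t * norm d)"
        using exp_ge_add_one_self[of "- (t * norm d)"] by (intro mult_right_mono) auto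
      then show ?thesis by (simp add: algebra_simps flip: exp_add)
    qed
    finally have "cosh_quot x d t \<le> norm d * cosh (norm x) * exp (t * norm d)"
      using t by (simp add: cosh_quot_def field_simps)
    then show ?thesis using cosh_gateaux_le[OF t, of x d] by simp
  qed
  then have "eventually (\<lambda>t. cosh_gateaux x d \<le> norm d * cosh (norm x) * exp (t * norm d)) (at_right 0)"
    by (auto simp: eventually_at_filter)
  moreover have "((\<lambda>t. norm d * cosh (norm x) * exp (t * norm d)) \<longlongrightarrow> norm d * cosh (norm x) * exp (0 * norm d)) (at_right 0)"
    by (intro tendsto_intros)
  ultimately show ?thesis
    using tendsto_lowerbound[where F = "at_right (0::real)"] by (auto simp: trivial_limit_at_right_real)
qed

lemma cosh_quot_add_minus_le:
  fixes x d :: "'b::real_normed_vector"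
  assumes smooth: "beta_smooth \<beta> TYPE('b)" and t: "0 < t" "t \<le> 1"
  shows "cosh_quot x d t + cosh_quot x (- d) t \<le> t * (\<beta>\<^sup>2 * (norm d)\<^sup>2 * cosh (norm x + norm d))"
proof -
  have "t * (cosh_quot x d t + cosh_quot x (- d) t)
      = cosh (norm (x + t *\<^sub>R d)) + cosh (norm (x - t *\<^sub>R d)) - 2 * cosh (norm x)"
    using t by (simp add: cosh_quot_def field_simps)
  also have "\<dots> \<le> \<beta>\<^sup>2 * (norm (t *\<^sub>R d))\<^sup>2 * cosh (norm x + norm (t *\<^sub>R d))"
    by (rule cosh_norm_second_difference[OF smooth])
  also have "\<dots> \<le> \<beta>\<^sup>2 * (norm (t *\<^sub>R d))\<^sup>2 * cosh (norm x + norm d)"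
    using t by (intro mult_left_mono cosh_mono_nonneg) (auto simp: mult_left_le_one_le)
  also have "\<dots> = t * (t * (\<beta>\<^sup>2 * (norm d)\<^sup>2 * cosh (norm x + norm d)))"
    using t by (simp add: power2_eq_square)
  finally show ?thesis using t by (simp only: mult_le_cancel_left_pos)
qed

text \<open>This is where smoothness yields differentiability. Convexity alone gives a nonnegative
  sum of forward and backward slopes; the second-difference bound divided by t makes the sum at most
  a multiple of t.\<close>

lemma cosh_gateaux_minus:
  fixes x d :: "'b::real_normed_vector"
  assumes smooth: "beta_smooth \<beta> TYPE('b)"
  shows "cosh_gateaux x (- d) = - cosh_gateaux x d"
proof -
  define C where "C = \<beta>\<^sup>2 * (norm d)\<^sup>2 * cosh (norm x + norm d)"
  have "cosh_gateaux x d + cosh_gateaux x (- d) \<le> t * C" if "0 < t" "t \<le> 1" for t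
    using cosh_quot_add_minus_le[OF smooth that, of x d] cosh_gateaux_le[OF that(1), of x d]
      cosh_gateaux_le[OF that(1), of x "- d"] by (simp add: C_def)
  then have "eventually (\<lambda>t. cosh_gateaux x d + cosh_gateaux x (- d) \<le> t * C) (at_right 0)"
    by (auto simp: eventually_at intro!: exI[of _ 1])
  moreover have "((\<lambda>t. t * C) \<longlongrightarrow> 0 * C) (at_right 0)"
    by (intro tendsto_intros)
  ultimately have "cosh_gateaux x d + cosh_gateaux x (- d) \<le> 0"
    using tendsto_lowerbound[where F = "at_right (0::real)"] by (auto simp: trivial_limit_at_right_real)
  moreover have "0 \<le> cosh_gateaux x d + cosh_gateaux x (- d)"
    using cosh_gateaux_subadditive[of x d "- d"] by simp
  ultimately show ?thesis by simp
qed

lemma abs_cosh_gateaux_le: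
  fixes x d :: "'b::real_normed_vector"
  assumes smooth: "beta_smooth \<beta> TYPE('b)"
  shows "\<bar>cosh_gateaux x d\<bar> \<le> norm d * cosh (norm x)"
  using cosh_gateaux_le_norm[of x d] cosh_gateaux_le_norm[of x "- d"] 
  by (simp add: cosh_gateaux_minus[OF smooth])

text \<open>Subadditivity at the opposite vectors becomes superadditivity once signs can be pulled
  out.\<close>

lemma bounded_linear_cosh_gateaux:
  fixes x :: "'b::real_normed_vector"
  assumes smooth: "beta_smooth \<beta> TYPE('b)"
  shows "bounded_linear (cosh_gateaux x)"
proof (rule bounded_linear_intro)
  show "cosh_gateaux x (d + e) = cosh_gateaux x d + cosh_gateaux x e" for d e
    using cosh_gateaux_subadditive[of x d e] cosh_gateaux_subadditive[of x "- d" "- e"]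
      cosh_gateaux_minus[OF smooth, of x "d + e"]
    by (simp add: cosh_gateaux_minus[OF smooth])
  show "cosh_gateaux x (c *\<^sub>R d) = c *\<^sub>R cosh_gateaux x d" for c d
  proof (cases c "0::real" rule: linorder_cases)
    case less
    then show ?thesis
      using cosh_gateaux_scaleR_pos[of "- c" x d] by (simp add: cosh_gateaux_minus[OF smooth])
  qed (auto simp: cosh_gateaux_scaleR_pos)
  show "norm (cosh_gateaux x d) \<le> norm d * cosh (norm x)" for d
    using abs_cosh_gateaux_le[OF smooth] by simp
qed

section \<open>From second differences to an expansion at arbitrary distance\<close>

lemma concave_sequence_le:
  fixes f :: "nat \<Rightarrow> real"
  assumes "\<And>k. Suc k < N \<Longrightarrow> f (Suc (Suc k)) + f k \<le> 2 * f (Suc k)"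
  shows "f N - f 0 \<le> real N * (f 1 - f 0)"
proof -
  have step: "k < N \<Longrightarrow> f (Suc k) - f k \<le> f 1 - f 0" for k
  proof (induction k)
    case (Suc k)
    then show ?case using assms[of k] by simp
  qed simp
  have "n \<le> N \<Longrightarrow> f n - f 0 \<le> real n * (f 1 - f 0)" for n
  proof (induction n)
    case (Suc n)
    then show ?case using step[of n] by (simp add: algebra_simps)
  qed simp
  then show ?thesis by simp
qed

text \<open>The right side is 4 sinh^2 (r / 2). It is also the relative second difference of the
  sequence exp (k r), which can therefore absorb a second difference of order r^2.\<close>

lemma power2_le_exp_add_exp_minus:
  fixes r :: real
  assumes "0 \<le> r"
  shows "r\<^sup>2 \<le> exp r + exp (- r) - 2"
proof -
  have s: "r / 2 \<le> sinh (r / 2)"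
  proof -
    have "0 - sinh 0 \<ge> r/2 - sinh (r / 2)"
    proof (rule DERIV_nonpos_imp_nonincreasing[of 0 "r/2"])
      fix t :: real
      show "\<exists>y. ((\<lambda>t. t - sinh t) has_real_derivative y) (at t) \<and> y \<le> 0"
        using cosh_real_ge_1[of t]
        by (intro exI[of _ "1 - cosh t"]) (auto intro!: derivative_eq_intros)
    qed (use assms in simp)
    then show ?thesis by simp
  qed
  have "(r / 2)\<^sup>2 \<le> (sinh (r / 2))\<^sup>2"
    using s assms by (intro power_mono) auto
  moreover have "exp r + exp (- r) = 4 * (sinh (r / 2))\<^sup>2 + 2"
    using cosh_double[of "r / 2"] cosh_square_eq[of "r / 2"] by (simp add: cosh_field_def)
  ultimately show ?thesis by (simp add: power2_eq_square)
qed

text \<open>Along the grid \<open>x + (k / N) d\<close> the function \<open>cosh (norm _)\<close> minus a multiple of the exponential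
  has nonpositive second differences, so its total increment is at most \<open>N\<close> times the first one.\<close>

lemma cosh_norm_add_le_quot:
  fixes x d :: "'b::real_normed_vector"
  assumes smooth: "beta_smooth \<beta> TYPE('b)" and N: "0 < N"
  shows "cosh (norm (x + d)) - cosh (norm x) \<le> cosh_quot x d (1 / real N)
     + \<beta>\<^sup>2 * cosh (norm x) * exp (norm d / real N) * (exp (norm d) - 1 - norm d)"
proof -
  define r where "r = norm d / real N"
  \<comment> \<open>The factor exp r arises because the second difference centred at one grid point
    is bounded by cosh one step further out. It tends to 1 as the grid is refined.\<close>
  define C where "C = \<beta>\<^sup>2 * cosh (norm x) * exp r"
  define h where "h k = cosh (norm (x + (real k / real N) *\<^sub>R d))" for k
  have r: "0 \<le> r" by (simp add: r_def)
  have C: "0 \<le> C" by (simp add: C_def)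
  have second: "h (Suc (Suc k)) + h k - 2 * h (Suc k) \<le> C * (exp (real (Suc (Suc k)) * r) + exp (real k * r) - 2 * exp (real (Suc k) * r))" for k
  proof -
    define y where "y = x + (real (Suc k) / real N) *\<^sub>R d"
    define z where "z = (1 / real N) *\<^sub>R d"
    have nz: "norm z = r" by (simp add: z_def r_def)
    have two: "(2 / real N) *\<^sub>R d = (1 / real N) *\<^sub>R d + (1 / real N) *\<^sub>R d"
      by (simp flip: scaleR_add_left)
    have hs: "h (Suc (Suc k)) = cosh (norm (y + z))" "h k = cosh (norm (y - z))" "h (Suc k) = cosh (norm y)"
      by (simp_all add: h_def y_def z_def algebra_simps add_divide_distrib two)
    have "norm y \<le> norm x + norm ((real (Suc k) / real N) *\<^sub>R d)"
      unfolding y_def by (rule norm_triangle_ineq)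
    also have "norm ((real (Suc k) / real N) *\<^sub>R d) = real (Suc k) * r"
      by (simp add: r_def)
    finally have ny: "norm y + r \<le> norm x + (real (Suc k) * r + r)" by simp
    have "h (Suc (Suc k)) + h k - 2 * h (Suc k) \<le> \<beta>\<^sup>2 * r\<^sup>2 * cosh (norm y + r)"
      unfolding hs using cosh_norm_second_difference[OF smooth, of y z] by (simp add: nz)
    also have "cosh (norm y + r) \<le> cosh (norm x + (real (Suc k) * r + r))"
      using ny r by (intro cosh_mono_nonneg) auto
    also have "\<dots> \<le> cosh (norm x) * exp (real (Suc k) * r + r)"
      using r by (intro cosh_add_le_exp) auto
    also have "\<beta>\<^sup>2 * r\<^sup>2 * (cosh (norm x) * exp (real (Suc k) * r + r)) = C * exp (real (Suc k) * r) * r\<^sup>2"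
      unfolding C_def exp_add by (simp add: mult_ac)
    also have "\<dots> \<le> C * exp (real (Suc k) * r) * (exp r + exp (- r) - 2)"
      using C power2_le_exp_add_exp_minus[OF r] by (intro mult_left_mono) auto
    also have "\<dots> = C * (exp (real (Suc (Suc k)) * r) + exp (real k * r) - 2 * exp (real (Suc k) * r))"
      by (simp add: algebra_simps flip: exp_add)
    finally show ?thesis by (simp add: mult_left_mono)
  qed
  have "(h N - C * exp (real N * r)) - (h 0 - C * exp (real 0 * r))
     \<le> real N * ((h 1 - C * exp (real 1 * r)) - (h 0 - C * exp (real 0 * r)))"
    by (rule concave_sequence_le) (use second in \<open>force simp: algebra_simps\<close>)
  moreover have "real N * r = norm d" "h N = cosh (norm (x + d))" "h 0 = cosh (norm x)"
    using N by (auto simp: r_def h_def)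
  moreover have "real N * (h 1 - h 0) = cosh_quot x d (1 / real N)"
    using N by (simp add: h_def cosh_quot_def)
  ultimately have "cosh (norm (x + d)) - cosh (norm x)
     \<le> cosh_quot x d (1 / real N) + C * (exp (norm d) - 1 - real N * (exp r - 1))"
    by (simp add: algebra_simps)
  also have "\<dots> \<le> cosh_quot x d (1 / real N) + C * (exp (norm d) - 1 - norm d)"
  proof -
    have "norm d \<le> real N * (exp r - 1)"
      using mult_left_mono[of r "exp r - 1" "real N"] exp_ge_add_one_self[of r] \<open>real N * r = norm d\<close> by simp
    then show ?thesis using C by (intro add_left_mono mult_left_mono) auto
  qed
  finally show ?thesis by (simp add: C_def r_def)
qed

text \<open>Limit of the grid estimate: the quotient at step 1 / N exceeds the derivative by O(1 /
  N), and the surplus exponential factor tends to 1.\<close>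

lemma cosh_norm_add_le:
  fixes x d :: "'b::real_normed_vector"
  assumes smooth: "beta_smooth \<beta> TYPE('b)"
  shows "cosh (norm (x + d)) \<le> cosh (norm x) + cosh_gateaux x d
     + \<beta>\<^sup>2 * cosh (norm x) * (exp (norm d) - 1 - norm d)"
proof -
  define E where "E = exp (norm d) - 1 - norm d"
  define C where "C = \<beta>\<^sup>2 * (norm d)\<^sup>2 * cosh (norm x + norm d)"
  have le: "cosh (norm (x + d)) - cosh (norm x) \<le> cosh_gateaux x d + C * inverse (real (Suc n))
     + \<beta>\<^sup>2 * cosh (norm x) * exp (norm d * inverse (real (Suc n))) * E" for n
  proof -
    define t where "t = 1 / real (Suc n)"
    have t: "0 < t" "t \<le> 1" by (auto simp: t_def)
    \<comment> \<open>The backward quotient is at least the derivative along -d, so the bound on the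
      sum of both quotients becomes an upper bound on the forward one.\<close>
    have "cosh_quot x d t \<le> cosh_gateaux x d + C * t"
      using cosh_quot_add_minus_le[OF smooth t, of x d] cosh_gateaux_le[OF t(1), of x "- d"]
      by (simp add: cosh_gateaux_minus[OF smooth] C_def mult.commute)
    then show ?thesis
      using cosh_norm_add_le_quot[OF smooth, of "Suc n" x d]
      by (simp add: t_def E_def inverse_eq_divide)
  qed
  have "(\<lambda>n. cosh_gateaux x d + C * inverse (real (Suc n))
     + \<beta>\<^sup>2 * cosh (norm x) * exp (norm d * inverse (real (Suc n))) * E)
     \<longlonglongrightarrow> cosh_gateaux x d + C * 0 + \<beta>\<^sup>2 * cosh (norm x) * exp (norm d * 0) * E"
    by (intro tendsto_intros LIMSEQ_inverse_real_of_nat)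
  then have "cosh (norm (x + d)) - cosh (norm x) \<le>
      cosh_gateaux x d + C * 0 + \<beta>\<^sup>2 * cosh (norm x) * exp (norm d * 0) * E"
    by (rule LIMSEQ_le_const) (use le in blast)
  then show ?thesis by (simp add: E_def)
qed

section \<open>One truncated increment\<close>

text \<open>The ratio (exp w - 1 - w) / w^2 has a power series with nonnegative coefficients, so it
  is largest at w = b. The choice b = 2 / \<beta> gives the fraction in
  \<open>C_const\<close>.\<close>

lemma exp_remainder_le:
  fixes w b :: real
  assumes "0 \<le> w" "w \<le> b" "0 < b"
  shows "exp w - 1 - w \<le> (exp b - b - 1) / b\<^sup>2 * w\<^sup>2"
proof -
  have series: "(\<lambda>n. x ^ (n + 2) / fact (n + 2)) sums (exp x - 1 - x)" for x :: real
  proof -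
    have "(\<lambda>n. x ^ n /\<^sub>R fact n) sums exp x" by (rule exp_converges)
    from sums_split_initial_segment[OF this, of 2] show ?thesis
      by (simp add: divide_inverse mult.commute numeral_2_eq_2 diff_diff_eq)
  qed
  have "exp w - 1 - w \<le> (w / b)\<^sup>2 * (exp b - 1 - b)"
  proof (rule sums_le[OF _ series sums_mult[OF series]])
    fix n
    have "w ^ n \<le> b ^ n" using assms by (intro power_mono) auto
    then have "w\<^sup>2 * w ^ n / fact (n + 2) \<le> w\<^sup>2 * b ^ n / fact (n + 2)"
      by (intro divide_right_mono mult_left_mono) auto
    moreover have "w\<^sup>2 * b ^ n = (w / b)\<^sup>2 * b ^ (n + 2)"
      using assms by (simp add: power_add power_divide power2_eq_square)
    moreover have "w\<^sup>2 * w ^ n = w ^ (n + 2)"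
      by (simp add: power_add power2_eq_square)
    ultimately show "w ^ (n + 2) / fact (n + 2) \<le> (w / b)\<^sup>2 * (b ^ (n + 2) / fact (n + 2))"
      by (simp only: times_divide_eq_right)
  qed
  then show ?thesis by (simp add: power_divide field_simps)
qed

lemma exp_remainder_coeff_ge_half:
  fixes b :: real
  assumes "0 < b"
  shows "1 / 2 \<le> (exp b - b - 1) / b\<^sup>2"
  using exp_lower_Taylor_quadratic[of b] assms by (simp add: field_simps)

text \<open>The tangent at s = 1, read off from Young's inequality with second factor 1. It yields
  both the constant \<open>K_const\<close> and the instance of Jensen's inequality in
  \<open>norm_mean_powr_le\<close>.\<close>

lemma powr_ge_tangent:
  fixes s p :: real
  assumes "0 \<le> s" "1 < p"
  shows "1 + p * (s - 1) \<le> s powr p"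
proof -
  have "s * 1 \<le> s powr p / p + 1 powr (p / (p - 1)) / (p / (p - 1))"
    using assms by (intro Youngs_inequality) (auto simp: field_simps)
  also have "\<dots> = (s powr p + (p - 1)) / p"
    using assms by (simp add: add_divide_distrib)
  finally show ?thesis using assms by (simp add: pos_le_divide_eq algebra_simps)
qed

context
  fixes p :: real
  assumes p: "1 < p"
begin

lemma K_const_nonneg: "0 \<le> K_const p"
  using p by (simp add: K_const_def)

lemma K_const_le_1: "K_const p \<le> 1"
proof -
  have "((p - 1) / p) powr (p - 1) \<le> 1 powr (p - 1)"
    using p by (intro powr_mono2) auto
  then have "1 / p * ((p - 1) / p) powr (p - 1) \<le> 1 * 1"
    using p by (intro mult_mono) auto
  then show ?thesis by (simp add: K_const_def)
qed

text \<open>\<open>K_const p\<close> is the maximum of \<open>(t - 1) / t powr p\<close>, attained at \<open>t = p / (p - 1)\<close>.\<close>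

lemma diff_one_le_K_const:
  assumes "0 \<le> t"
  shows "t - 1 \<le> K_const p * t powr p"
proof -
  \<comment> \<open>The reciprocal of the maximiser, so that the tangent at s = t q = 1 touches
    exactly at t = p / (p - 1).\<close>
  define q where "q = (p - 1) / p"
  have q: "0 < q" using p by (simp add: q_def)
  have "1 + p * (t * q - 1) \<le> (t * q) powr p"
    using powr_ge_tangent[of "t * q" p] assms p q by simp
  have "(p - 1) * (t - 1) \<le> t powr p * q powr p"
  proof -
    have "p * q = p - 1" using p by (simp add: q_def)
    then have "1 + p * (t * q - 1) = (p - 1) * (t - 1)"
      by (simp add: right_diff_distrib mult.left_commute[of p t q]) (simp add: algebra_simps)
    then show ?thesis
      using \<open>1 + p * (t * q - 1) \<le> (t * q) powr p\<close> assms q by (simp add: powr_mult)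
  qed
  also have "q powr p = q powr (p - 1) * q"
    using q powr_add[of q "p - 1" 1] by simp
  also have "t powr p * (q powr (p - 1) * q) = (p - 1) * (K_const p * t powr p)"
    using p by (simp add: K_const_def q_def)
  finally show ?thesis using p by simp
qed

lemma K_const_ge: "1 \<le> K_const p * 2 powr p"
  using diff_one_le_K_const[of 2] by simp

end

section \<open>Size of the truncated vector and of the truncation error\<close>

lemma norm_Trunc_scaleR:
  fixes x :: "'b::real_normed_vector"
  assumes "0 < lam"
  shows "lam * norm (Trunc (lam *\<^sub>R x) *\<^sub>R x) = min (lam * norm x) 1"
  using assms by (auto simp: Trunc_def min_def field_simps)

lemma norm_diff_Trunc_scaleR:
  fixes x :: "'b::real_normed_vector"
  assumes "0 < lam"
  shows "lam * norm (x - Trunc (lam *\<^sub>R x) *\<^sub>R x) = max (lam * norm x - 1) 0"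
proof -
  have "x - Trunc (lam *\<^sub>R x) *\<^sub>R x = (1 - Trunc (lam *\<^sub>R x)) *\<^sub>R x"
    by (simp add: algebra_simps)
  then have "norm (x - Trunc (lam *\<^sub>R x) *\<^sub>R x) = \<bar>1 - Trunc (lam *\<^sub>R x)\<bar> * norm x"
    by simp
  then show ?thesis
    using assms by (auto simp: Trunc_def min_def max_def field_simps)
qed

text \<open>With s = lam * norm x the claim is (min s 1)^2 \<le> s powr p: for s \<le> 1 the smaller
  exponent gives the larger power, and for s > 1 the sides lie on either side of 1. Truncation thus
  trades a second moment for a p-th moment.\<close>

lemma norm_Trunc_scaleR_sq_le:
  fixes x :: "'b::real_normed_vector"
  assumes "0 < lam" "0 \<le> p" "p \<le> 2"
  shows "(lam * norm (Trunc (lam *\<^sub>R x) *\<^sub>R x))\<^sup>2 \<le> (lam * norm x) powr p"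
proof (cases "lam * norm x \<le> 1")
  case True
  show ?thesis
  proof (cases "x = 0")
    case False
    then have pos: "0 < lam * norm x" using assms by simp
    have "(lam * norm x) powr 2 \<le> (lam * norm x) powr p"
      using True assms pos by (intro powr_mono') auto
    then show ?thesis unfolding norm_Trunc_scaleR[OF assms(1)] using True pos by simp
  qed simp
next
  case False
  then show ?thesis
    unfolding norm_Trunc_scaleR[OF assms(1)] using assms by (simp add: min_def ge_one_powr_ge_zero)
qed

text \<open>The loss is the positive part of lam * norm x - 1, whose best bound by a multiple of the
  p-th power has constant \<open>K_const p\<close>.\<close>

lemma norm_diff_Trunc_scaleR_le:
  fixes x :: "'b::real_normed_vector"
  assumes "0 < lam" "1 < p"
  shows "lam * norm (x - Trunc (lam *\<^sub>R x) *\<^sub>R x) \<le> K_const p * (lam * norm x) powr p"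
  using diff_one_le_K_const[OF assms(2), of "lam * norm x"] K_const_nonneg[OF assms(2)] assms(1)
  by (simp add: norm_diff_Trunc_scaleR)

lemma borel_measurable_Trunc [measurable]:
  "(Trunc :: 'b::{real_normed_vector, second_countable_topology} \<Rightarrow> real) \<in> borel_measurable borel"
  unfolding Trunc_def[abs_def] by measurable

section \<open>Conditional moments as integrals over sets of the past\<close>

lemma integrable_imp_set_integrable:
  fixes f :: "'a \<Rightarrow> 'c::{banach, second_countable_topology}"
  shows "integrable M f \<Longrightarrow> A \<in> sets M \<Longrightarrow> set_integrable M A f"
  unfolding set_integrable_def by (rule integrable_mult_indicator)

lemma (in finite_measure) set_integral_affine:
  fixes f g :: "'a \<Rightarrow> real"
  assumes f: "integrable M f" and g: "integrable M g" and A: "A \<in> sets M"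
  shows "(LINT \<omega>:A|M. a + b * f \<omega> + c * g \<omega>)
    = a * measure M A + b * (LINT \<omega>:A|M. f \<omega>) + c * (LINT \<omega>:A|M. g \<omega>)"
proof -
  note si = integrable_imp_set_integrable[OF _ A]
  have "(LINT \<omega>:A|M. a + b * f \<omega> + c * g \<omega>)
      = (LINT \<omega>:A|M. a + b * f \<omega>) + (LINT \<omega>:A|M. c * g \<omega>)"
    by (intro set_integral_add(2) si Bochner_Integration.integrable_add integrable_mult_right
        integrable_const f g)
  also have "(LINT \<omega>:A|M. a + b * f \<omega>) = (LINT \<omega>:A|M. a) + (LINT \<omega>:A|M. b * f \<omega>)"
    by (intro set_integral_add(2) si integrable_mult_right integrable_const f)
  finally show ?thesis
    using A by (simp add: set_integral_const emeasure_eq_measure)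
qed

locale bounded_moment = prob_space M for M :: "'a measure" +
  fixes G :: "'a measure" and Y :: "'a \<Rightarrow> 'b::{banach, second_countable_topology}"
    and \<mu> :: 'b and p v :: real
  assumes subalg: "subalgebra M G"
    and Y_meas [measurable]: "Y \<in> borel_measurable M"
    and mean: "cond_exp_is_const M G Y \<mu>"
    and moment: "AE \<omega> in M. nn_cond_exp M G (\<lambda>\<omega>. ennreal (norm (Y \<omega>) powr p)) \<omega> \<le> ennreal v"
    and p: "1 < p" "p \<le> 2"
    and v: "v > 0"
begin

lemma sets_G [measurable_dest]: "A \<in> sets G \<Longrightarrow> A \<in> sets M"
  using subalg by (auto simp: subalgebra_def)

lemma space_G: "space M \<in> sets G"
  using subalg sets.top[of G] by (auto simp: subalgebra_def)

lemma Y_integrable: "integrable M Y"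
  using mean by (simp add: cond_exp_is_const_def)

lemma nn_integral_moment:
  assumes A: "A \<in> sets G"
  shows "(\<integral>\<^sup>+\<omega>. indicator A \<omega> * ennreal (norm (Y \<omega>) powr p) \<partial>M) \<le> ennreal (v * measure M A)"
proof -
  interpret sub: finite_measure_subalgebra M G
    by unfold_locales (rule subalg)
  have [measurable]: "A \<in> sets M" using A by (rule sets_G)
  have "(\<integral>\<^sup>+\<omega>. indicator A \<omega> * ennreal (norm (Y \<omega>) powr p) \<partial>M)
      = (\<integral>\<^sup>+\<omega>. indicator A \<omega> * nn_cond_exp M G (\<lambda>\<omega>. ennreal (norm (Y \<omega>) powr p)) \<omega> \<partial>M)"
    using A by (intro sub.nn_cond_exp_intg[symmetric]) auto
  also have "\<dots> \<le> (\<integral>\<^sup>+\<omega>. ennreal v * indicator A \<omega> \<partial>M)"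
    using moment by (intro nn_integral_mono_AE) (auto elim!: eventually_mono simp: indicator_def)
  also have "\<dots> = ennreal (v * measure M A)"
    using v by (simp add: nn_integral_cmult_indicator emeasure_eq_measure ennreal_mult)
  finally show ?thesis .
qed

lemma moment_integrable: "integrable M (\<lambda>\<omega>. norm (Y \<omega>) powr p)"
proof (rule integrableI_bounded)
  have "(\<integral>\<^sup>+\<omega>. ennreal (norm (norm (Y \<omega>) powr p)) \<partial>M)
      = (\<integral>\<^sup>+\<omega>. indicator (space M) \<omega> * ennreal (norm (Y \<omega>) powr p) \<partial>M)"
    by (intro nn_integral_cong) auto
  also have "\<dots> \<le> ennreal (v * measure M (space M))"
    by (rule nn_integral_moment[OF space_G])
  finally show "(\<integral>\<^sup>+\<omega>. ennreal (norm (norm (Y \<omega>) powr p)) \<partial>M) < \<infinity>"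
    by (rule le_less_trans) simp
qed simp

lemma set_integral_moment:
  assumes A: "A \<in> sets G"
  shows "(LINT \<omega>:A|M. norm (Y \<omega>) powr p) \<le> v * measure M A"
proof -
  have "ennreal (LINT \<omega>:A|M. norm (Y \<omega>) powr p)
      = (\<integral>\<^sup>+\<omega>. ennreal (indicator A \<omega> *\<^sub>R norm (Y \<omega>) powr p) \<partial>M)"
    unfolding set_lebesgue_integral_def using A
    by (intro nn_integral_eq_integral[symmetric] integrable_mult_indicator moment_integrable sets_G) auto
  also have "\<dots> = (\<integral>\<^sup>+\<omega>. indicator A \<omega> * ennreal (norm (Y \<omega>) powr p) \<partial>M)"
    by (intro nn_integral_cong) (auto simp: indicator_def)
  also note nn_integral_moment[OF A]
  finally show ?thesis using v by (simp add: ennreal_le_iff)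
qed

text \<open>All that is used of the vector-valued conditional mean in the drift estimates. The
  functional is either \<open>cosh_gateaux x\<close> or, in a Hilbert space, the inner product with
  \<mu>.\<close>

lemma set_integral_bounded_linear:
  fixes f :: "'b \<Rightarrow> real"
  assumes f: "bounded_linear f" and A: "A \<in> sets G"
  shows "(LINT \<omega>:A|M. f (Y \<omega>)) = measure M A * f \<mu>"
proof -
  interpret f: bounded_linear f by (rule f)
  have "(LINT \<omega>:A|M. f (Y \<omega>)) = (LINT \<omega>|M. f (indicator A \<omega> *\<^sub>R Y \<omega>))"
    unfolding set_lebesgue_integral_def by (simp add: f.scaleR)
  also have "\<dots> = f (LINT \<omega>:A|M. Y \<omega>)"
    unfolding set_lebesgue_integral_def using A
    by (intro integral_bounded_linear[OF f] integrable_mult_indicator Y_integrable sets_G)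
  also have "\<dots> = measure M A * f \<mu>"
    using mean A by (simp add: cond_exp_is_const_def f.scaleR)
  finally show ?thesis .
qed

text \<open>Jensen's inequality: the tangent line of s powr p at 1 is integrated with s = norm Y /
  norm \<mu>.\<close>

lemma norm_mean_powr_le: "norm \<mu> powr p \<le> v"
proof (cases "\<mu> = 0")
  case False
  define a where "a = norm \<mu>"
  have a: "0 < a" using False by (simp add: a_def)
  have int: "integrable M (\<lambda>\<omega>. norm (Y \<omega>))" using Y_integrable by (rule integrable_norm)
  have "\<mu> = (LINT \<omega>|M. Y \<omega>)"
    using mean space_G by (auto simp: cond_exp_is_const_def set_integral_space prob_space)
  then have "a \<le> (LINT \<omega>|M. norm (Y \<omega>))"
    by (simp add: a_def integral_norm_bound)
  \<comment> \<open>The bracket is at least 1 because the mean of norm Y is at least a.\<close>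
  then have "a powr p \<le> a powr p * (1 + p * ((LINT \<omega>|M. norm (Y \<omega>)) / a - 1))"
    using a p by (simp add: field_simps)
  also have "\<dots> = (LINT \<omega>|M. a powr p * (1 + p * (norm (Y \<omega>) / a - 1)))"
    using int by (simp add: prob_space)
  also have "\<dots> \<le> (LINT \<omega>|M. norm (Y \<omega>) powr p)"
  proof (rule integral_mono)
    fix \<omega>
    have "a powr p * (1 + p * (norm (Y \<omega>) / a - 1)) \<le> a powr p * (norm (Y \<omega>) / a) powr p"
      using a p by (intro mult_left_mono powr_ge_tangent) auto
    then show "a powr p * (1 + p * (norm (Y \<omega>) / a - 1)) \<le> norm (Y \<omega>) powr p"
      using a by (simp add: powr_divide)
  qed (use int moment_integrable in auto)
  also have "\<dots> \<le> v"
    using set_integral_moment[OF space_G] moment_integrable by (simp add: set_integral_space prob_space)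
  finally show ?thesis by (simp add: a_def)
qed (use v in simp)

end

text \<open>Bound on the relative drift of the potential in one step: truncation bias plus
  second-order remainder. The factors 2 and 4 are those of the two second-moment bounds for the
  centred truncated variable.\<close>

definition growth :: "real \<Rightarrow> real \<Rightarrow> real \<Rightarrow> real \<Rightarrow> 'b::real_normed_vector itself \<Rightarrow> real" where
  "growth p v lam \<beta> B = lam powr p * v * (K_const p / \<beta> + (if is_hilbert B then 2 else 4)
     * ((exp (2 / \<beta>) - 2 / \<beta> - 1) / (2 / \<beta>)\<^sup>2))"

text \<open>The increment is centred at \<open>\<mu>\<close> rather than at the conditional mean of the truncated variable:
  the bias then enters through the linear term of the expansion, and no vector-valued conditional
  expectation is needed. This requires \<open>lam * norm \<mu> \<le> 1\<close>, which follows from \<open>small\<close>.\<close>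

locale truncated_step = bounded_moment M G Y \<mu> p v
  for M :: "'a measure" and G and Y :: "'a \<Rightarrow> 'b::{banach, second_countable_topology}" and \<mu> p v +
  fixes lam :: real
  assumes lam: "0 < lam" and small: "lam powr p * v \<le> 1"
begin

definition T :: "'a \<Rightarrow> 'b" where
  "T \<omega> = Trunc (lam *\<^sub>R Y \<omega>) *\<^sub>R Y \<omega>"

lemma T_meas [measurable]: "T \<in> borel_measurable M"
  unfolding T_def by measurable

lemma scaled_norm_mean_powr_le: "(lam * norm \<mu>) powr p \<le> lam powr p * v"
  using norm_mean_powr_le lam by (simp add: powr_mult)

lemma scaled_norm_mean_le_1: "lam * norm \<mu> \<le> 1"
proof (rule ccontr)
  assume "\<not> ?thesis"
  then have "1 powr p < (lam * norm \<mu>) powr p" using p by (intro powr_less_mono2) auto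
  then show False using scaled_norm_mean_powr_le small by simp
qed

lemma scaled_norm_mean_sq_le: "(lam * norm \<mu>)\<^sup>2 \<le> lam powr p * v"
proof (cases "\<mu> = 0")
  case False
  then have pos: "0 < lam * norm \<mu>" using lam by simp
  have "(lam * norm \<mu>)\<^sup>2 = (lam * norm \<mu>) powr 2" using pos by simp
  also have "\<dots> \<le> (lam * norm \<mu>) powr p"
    using pos scaled_norm_mean_le_1 p by (intro powr_mono') auto
  finally show ?thesis using scaled_norm_mean_powr_le by simp
qed (use lam v in simp)

lemma scaled_norm_T_le_1: "lam * norm (T \<omega>) \<le> 1"
  unfolding T_def norm_Trunc_scaleR[OF lam] by simp

lemma scaled_norm_diff_le_2: "lam * norm (T \<omega> - \<mu>) \<le> 2"
proof -
  have "lam * norm (T \<omega> - \<mu>) \<le> lam * (norm (T \<omega>) + norm \<mu>)"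
    using lam by (intro mult_left_mono norm_triangle_ineq4) auto
  then show ?thesis
    using scaled_norm_T_le_1[of \<omega>] scaled_norm_mean_le_1 by (simp add: distrib_left)
qed

lemma scaled_moment_integrable: "integrable M (\<lambda>\<omega>. (lam * norm (Y \<omega>)) powr p)"
  using moment_integrable lam by (simp add: powr_mult)

lemma set_integral_scaled_moment:
  "A \<in> sets G \<Longrightarrow> (LINT \<omega>:A|M. (lam * norm (Y \<omega>)) powr p) \<le> lam powr p * v * measure M A"
  using set_integral_moment[of A] lam by (simp add: powr_mult mult.assoc)

lemma scaled_sq_integrable: "integrable M (\<lambda>\<omega>. (lam * norm (T \<omega> - \<mu>))\<^sup>2)"
proof (rule integrable_const_bound[where B = 4])
  have "(lam * norm (T \<omega> - \<mu>))\<^sup>2 \<le> 2\<^sup>2" for \<omega>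
    using scaled_norm_diff_le_2[of \<omega>] lam by (intro power_mono) auto
  then show "AE \<omega> in M. norm ((lam * norm (T \<omega> - \<mu>))\<^sup>2) \<le> 4" by simp
qed simp

text \<open>The square of a sum is at most twice the sum of squares, and the contributions of T and
  of \<mu> are each at most lam powr p * v; hence 4.\<close>

lemma set_integral_sq_le_general:
  assumes A: "A \<in> sets G"
  shows "(LINT \<omega>:A|M. (lam * norm (T \<omega> - \<mu>))\<^sup>2) \<le> 4 * (lam powr p * v) * measure M A"
proof -
  have AM [measurable]: "A \<in> sets M" using A by (rule sets_G)
  note si = integrable_imp_set_integrable[OF _ AM]
  have "(LINT \<omega>:A|M. (lam * norm (T \<omega> - \<mu>))\<^sup>2)
      \<le> (LINT \<omega>:A|M. 2 * (lam * norm (Y \<omega>)) powr p + 2 * (lam * norm \<mu>)\<^sup>2)"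
  proof (rule set_integral_mono)
    fix \<omega>
    have "(lam * norm (T \<omega> - \<mu>))\<^sup>2 \<le> (lam * norm (T \<omega>) + lam * norm \<mu>)\<^sup>2"
      unfolding distrib_left[symmetric] using lam
      by (intro power_mono mult_left_mono norm_triangle_ineq4) auto
    also have "\<dots> \<le> 2 * (lam * norm (T \<omega>))\<^sup>2 + 2 * (lam * norm \<mu>)\<^sup>2"
      using sum_squares_bound[of "lam * norm (T \<omega>)" "lam * norm \<mu>"] unfolding power2_sum by linarith
    also have "(lam * norm (T \<omega>))\<^sup>2 \<le> (lam * norm (Y \<omega>)) powr p"
      unfolding T_def using lam p by (intro norm_Trunc_scaleR_sq_le) auto
    finally show "(lam * norm (T \<omega> - \<mu>))\<^sup>2 \<le> 2 * (lam * norm (Y \<omega>)) powr p + 2 * (lam * norm \<mu>)\<^sup>2"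
      by simp
  qed (auto intro!: si scaled_sq_integrable scaled_moment_integrable Bochner_Integration.integrable_add)
  also have "\<dots> = 2 * (LINT \<omega>:A|M. (lam * norm (Y \<omega>)) powr p) + 2 * (lam * norm \<mu>)\<^sup>2 * measure M A"
    using scaled_moment_integrable AM
    by (subst set_integral_add) (auto intro!: si simp: set_integral_const emeasure_eq_measure)
  also have "\<dots> \<le> 2 * (lam powr p * v * measure M A) + 2 * (lam powr p * v) * measure M A"
    using set_integral_scaled_moment[OF A] scaled_norm_mean_sq_le
    by (intro add_mono mult_left_mono mult_right_mono) auto
  finally show ?thesis by (simp add: algebra_simps)
qed

text \<open>An inner product allows the square to be expanded exactly. Replacing T by Y in the cross
  term makes its conditional mean -2 (norm \<mu>)^2, and this gain pays for the truncation error
  made in the replacement.\<close>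

lemma set_integral_sq_le_hilbert:
  assumes hilbert: "is_hilbert TYPE('b)" and A: "A \<in> sets G"
  shows "(LINT \<omega>:A|M. (lam * norm (T \<omega> - \<mu>))\<^sup>2) \<le> 2 * (lam powr p * v) * measure M A"
proof -
  obtain ip :: "'b \<Rightarrow> 'b \<Rightarrow> real" where add: "\<And>x y z. ip (x + y) z = ip x z + ip y z"
    and scale: "\<And>c x y. ip (c *\<^sub>R x) y = c * ip x y" and sym: "\<And>x y. ip x y = ip y x"
    and sq: "\<And>x. ip x x = (norm x)\<^sup>2"
    using hilbert unfolding is_hilbert_def by blast
  have minus: "ip (- x) y = - ip x y" for x y using scale[of "-1" x y] by simp
  have diff: "ip (x - y) z = ip x z - ip y z" for x y z
    using add[of x "- y" z] by (simp add: minus)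
  have add_right: "ip z (x + y) = ip z x + ip z y" for x y z
    using add[of x y z] by (simp only: sym[of z])
  have diff_right: "ip z (x - y) = ip z x - ip z y" for x y z
    using diff[of x y z] by (simp only: sym[of z])
  \<comment> \<open>Cauchy-Schwarz, obtained by squaring the triangle inequality.\<close>
  have le: "ip x y \<le> norm x * norm y" for x y
  proof -
    have "(norm (x + y))\<^sup>2 = (norm x)\<^sup>2 + 2 * ip x y + (norm y)\<^sup>2"
      unfolding sq[symmetric] by (simp add: add add_right sym[of y x])
    moreover have "(norm (x + y))\<^sup>2 \<le> (norm x + norm y)\<^sup>2"
      by (intro power_mono norm_triangle_ineq) auto
    ultimately show ?thesis by (simp add: power2_sum)
  qed
  have bl: "bounded_linear (\<lambda>x. ip x \<mu>)"
  proof (rule bounded_linear_intro[where K = "norm \<mu>"])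
    show "norm (ip x \<mu>) \<le> norm x * norm \<mu>" for x
      using le[of x \<mu>] le[of "- x" \<mu>] by (simp add: minus)
  qed (simp_all add: add scale)
  have AM [measurable]: "A \<in> sets M" using A by (rule sets_G)
  note si = integrable_imp_set_integrable[OF _ AM]
  define m where "m = lam * norm \<mu>"
  define K where "K = K_const p"
  define a where "a = lam powr p * v"
  have m: "0 \<le> m" "m \<le> 1" using lam scaled_norm_mean_le_1 by (auto simp: m_def)
  have K: "0 \<le> K" "K \<le> 1" using K_const_nonneg K_const_le_1 p by (auto simp: K_def)
  have a: "0 \<le> a" "a \<le> 1" using small v by (auto simp: a_def)
  have ip_int: "integrable M (\<lambda>\<omega>. ip (Y \<omega>) \<mu>)"
    by (rule integrable_bounded_linear[OF bl Y_integrable])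
  have "(LINT \<omega>:A|M. (lam * norm (T \<omega> - \<mu>))\<^sup>2)
      \<le> (LINT \<omega>:A|M. m\<^sup>2 + (1 + 2 * m * K) * (lam * norm (Y \<omega>)) powr p + (- 2 * lam\<^sup>2) * ip (Y \<omega>) \<mu>)"
  proof (rule set_integral_mono)
    fix \<omega>
    have "(norm (T \<omega> - \<mu>))\<^sup>2 = (norm (T \<omega>))\<^sup>2 - 2 * ip (T \<omega>) \<mu> + (norm \<mu>)\<^sup>2"
      unfolding sq[symmetric] by (simp add: diff diff_right sym[of \<mu> "T \<omega>"])
    also have "\<dots> = (norm (T \<omega>))\<^sup>2 - 2 * ip (Y \<omega>) \<mu> + 2 * ip (Y \<omega> - T \<omega>) \<mu> + (norm \<mu>)\<^sup>2"
      by (simp add: diff)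
    also have "\<dots> \<le> (norm (T \<omega>))\<^sup>2 - 2 * ip (Y \<omega>) \<mu> + 2 * (norm (Y \<omega> - T \<omega>) * norm \<mu>) + (norm \<mu>)\<^sup>2"
      using le[of "Y \<omega> - T \<omega>" \<mu>] by simp
    finally have "lam\<^sup>2 * (norm (T \<omega> - \<mu>))\<^sup>2 \<le>
        lam\<^sup>2 * ((norm (T \<omega>))\<^sup>2 - 2 * ip (Y \<omega>) \<mu> + 2 * (norm (Y \<omega> - T \<omega>) * norm \<mu>) + (norm \<mu>)\<^sup>2)"
      by (intro mult_left_mono) auto
    then have "(lam * norm (T \<omega> - \<mu>))\<^sup>2 \<le>
       (lam * norm (T \<omega>))\<^sup>2 - 2 * lam\<^sup>2 * ip (Y \<omega>) \<mu> + 2 * m * (lam * norm (Y \<omega> - T \<omega>)) + m\<^sup>2"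
      by (simp add: m_def power2_eq_square algebra_simps)
    also have "(lam * norm (T \<omega>))\<^sup>2 \<le> (lam * norm (Y \<omega>)) powr p"
      unfolding T_def using lam p by (intro norm_Trunc_scaleR_sq_le) auto
    also have "2 * m * (lam * norm (Y \<omega> - T \<omega>)) \<le> 2 * m * (K * (lam * norm (Y \<omega>)) powr p)"
      unfolding T_def K_def using lam p m by (intro mult_left_mono norm_diff_Trunc_scaleR_le) auto
    finally show "(lam * norm (T \<omega> - \<mu>))\<^sup>2
        \<le> m\<^sup>2 + (1 + 2 * m * K) * (lam * norm (Y \<omega>)) powr p + (- 2 * lam\<^sup>2) * ip (Y \<omega>) \<mu>"
      by (simp add: algebra_simps)
  qed (intro si scaled_sq_integrable scaled_moment_integrable ip_int integrable_mult_right
        integrable_const Bochner_Integration.integrable_add)+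
  also have "\<dots> = m\<^sup>2 * measure M A + (1 + 2 * m * K) * (LINT \<omega>:A|M. (lam * norm (Y \<omega>)) powr p)
      + (- 2 * lam\<^sup>2) * (LINT \<omega>:A|M. ip (Y \<omega>) \<mu>)"
    by (rule set_integral_affine[OF scaled_moment_integrable ip_int AM])
  also have "\<dots> = (1 + 2 * m * K) * (LINT \<omega>:A|M. (lam * norm (Y \<omega>)) powr p) - m\<^sup>2 * measure M A"
    by (simp add: set_integral_bounded_linear[OF bl A] sq m_def power_mult_distrib algebra_simps)
  also have "\<dots> \<le> (1 + 2 * m * K) * (a * measure M A) - m\<^sup>2 * measure M A"
    using set_integral_scaled_moment[OF A] m K
    by (intro diff_right_mono mult_left_mono) (auto simp: a_def)
  also have "\<dots> = ((1 + 2 * m * K) * a - m\<^sup>2) * measure M A" by (simp add: algebra_simps)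
  \<comment> \<open>From 2 m K \<le> m^2 + 1 the coefficient is at most 2 a + m^2 (a - 1), and a
    \<le> 1 by \<open>small\<close>.\<close>
  also have "\<dots> \<le> 2 * a * measure M A"
  proof (rule mult_right_mono)
    have "m\<^sup>2 * a \<le> m\<^sup>2" using a by (simp add: mult_left_le)
    moreover have "2 * m * K \<le> m\<^sup>2 + 1"
      using sum_squares_bound[of m K] power_le_one[OF K, of 2] by simp
    then have "(1 + 2 * m * K) * a \<le> (2 + m\<^sup>2) * a" using a by (intro mult_right_mono) auto
    ultimately show "(1 + 2 * m * K) * a - m\<^sup>2 \<le> 2 * a" by (simp add: algebra_simps)
  qed simp
  finally show ?thesis by (simp add: a_def)
qed

lemma set_integral_sq_le:
  assumes "A \<in> sets G"
  shows "(LINT \<omega>:A|M. (lam * norm (T \<omega> - \<mu>))\<^sup>2)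
     \<le> (if is_hilbert TYPE('b) then 2 else 4) * (lam powr p * v) * measure M A"
  using set_integral_sq_le_general[OF assms] set_integral_sq_le_hilbert[OF _ assms] by simp

text \<open>The expansion is integrated term by term over A: the bias term uses the Lipschitz bound
  on \<open>cosh_gateaux x\<close>, the remainder the second-moment bound. Every term carries the
  factor cosh (norm x), so the drift is multiplicative.\<close>

lemma set_integral_cosh_step:
  fixes x :: 'b
  assumes smooth: "beta_smooth \<beta> TYPE('b)" and \<beta>: "0 < \<beta>" and A: "A \<in> sets G"
  shows "(LINT \<omega>:A|M. cosh (norm (x + (lam / \<beta>) *\<^sub>R (T \<omega> - \<mu>))))
     \<le> (1 + growth p v lam \<beta> TYPE('b)) * cosh (norm x) * measure M A"
proof -
  have AM [measurable]: "A \<in> sets M" using A by (rule sets_G)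
  note si = integrable_imp_set_integrable[OF _ AM]
  define c where "c = (exp (2 / \<beta>) - 2 / \<beta> - 1) / (2 / \<beta>)\<^sup>2"
  define H where "H = cosh (norm x)"
  define \<psi> where "\<psi> = cosh_gateaux x"
  define U where "U \<omega> = (lam * norm (Y \<omega>)) powr p" for \<omega>
  define Q where "Q \<omega> = (lam * norm (T \<omega> - \<mu>))\<^sup>2" for \<omega>
  have "1 / 2 \<le> c" unfolding c_def using \<beta> by (intro exp_remainder_coeff_ge_half) auto
  then have c: "0 \<le> c" by simp
  have H: "0 \<le> H" by (simp add: H_def)
  have bl: "bounded_linear \<psi>" unfolding \<psi>_def by (rule bounded_linear_cosh_gateaux[OF smooth])
  interpret \<psi>: bounded_linear \<psi> by (rule bl)
  have \<psi>_int: "integrable M (\<lambda>\<omega>. \<psi> (Y \<omega>))"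
    by (rule integrable_bounded_linear[OF bl Y_integrable])
  have U_int: "integrable M U" unfolding U_def by (rule scaled_moment_integrable)
  have Q_int: "integrable M Q" unfolding Q_def by (rule scaled_sq_integrable)
  have norm_W: "norm ((lam / \<beta>) *\<^sub>R (T \<omega> - \<mu>)) = lam * norm (T \<omega> - \<mu>) / \<beta>" for \<omega>
    using lam \<beta> by simp
  have W_le: "norm ((lam / \<beta>) *\<^sub>R (T \<omega> - \<mu>)) \<le> 2 / \<beta>" for \<omega>
    unfolding norm_W using scaled_norm_diff_le_2[of \<omega>] \<beta> by (simp add: divide_right_mono)
  have "(LINT \<omega>:A|M. cosh (norm (x + (lam / \<beta>) *\<^sub>R (T \<omega> - \<mu>))))
      \<le> (LINT \<omega>:A|M. (H - lam / \<beta> * \<psi> \<mu>) + lam / \<beta> * \<psi> (Y \<omega>) + H * K_const p / \<beta> * U \<omega> + H * c * Q \<omega>)"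
  proof (rule set_integral_mono)
    fix \<omega>
    define W where "W = (lam / \<beta>) *\<^sub>R (T \<omega> - \<mu>)"
    have "cosh (norm (x + W)) \<le> H + \<psi> W + \<beta>\<^sup>2 * H * (exp (norm W) - 1 - norm W)"
      unfolding H_def \<psi>_def by (rule cosh_norm_add_le[OF smooth])
    \<comment> \<open>T - \<mu> is split as (Y - \<mu>) - (Y - T): the first part has conditional
      mean 0, the second is the truncation error.\<close>
    also have "\<psi> W = lam / \<beta> * \<psi> (Y \<omega>) - lam / \<beta> * \<psi> \<mu> - lam / \<beta> * \<psi> (Y \<omega> - T \<omega>)"
      by (simp add: W_def \<psi>.scaleR \<psi>.diff algebra_simps)
    also have "- (lam / \<beta> * \<psi> (Y \<omega> - T \<omega>)) \<le> H * K_const p / \<beta> * U \<omega>"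
    proof -
      have "- \<psi> (Y \<omega> - T \<omega>) \<le> norm (Y \<omega> - T \<omega>) * H"
        using abs_cosh_gateaux_le[OF smooth, of x "Y \<omega> - T \<omega>"] by (simp add: \<psi>_def H_def)
      then have "lam / \<beta> * - \<psi> (Y \<omega> - T \<omega>) \<le> lam / \<beta> * (norm (Y \<omega> - T \<omega>) * H)"
        using lam \<beta> by (intro mult_left_mono) auto
      also have "\<dots> = H / \<beta> * (lam * norm (Y \<omega> - T \<omega>))" by simp
      also have "\<dots> \<le> H / \<beta> * (K_const p * U \<omega>)"
        unfolding T_def U_def using lam p H \<beta> by (intro mult_left_mono norm_diff_Trunc_scaleR_le) auto
      finally show ?thesis by simp
    qed
    then have "lam / \<beta> * \<psi> (Y \<omega>) - lam / \<beta> * \<psi> \<mu> - lam / \<beta> * \<psi> (Y \<omega> - T \<omega>)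
        \<le> lam / \<beta> * \<psi> (Y \<omega>) - lam / \<beta> * \<psi> \<mu> + H * K_const p / \<beta> * U \<omega>" by simp
    also have "\<beta>\<^sup>2 * H * (exp (norm W) - 1 - norm W) \<le> \<beta>\<^sup>2 * H * (c * (norm W)\<^sup>2)"
      unfolding c_def using W_le[of \<omega>] \<beta> H
      by (intro mult_left_mono exp_remainder_le) (auto simp: W_def)
    also have "\<beta>\<^sup>2 * H * (c * (norm W)\<^sup>2) = H * c * Q \<omega>"
      unfolding W_def norm_W Q_def using \<beta> by (simp add: power_divide)
    finally show "cosh (norm (x + (lam / \<beta>) *\<^sub>R (T \<omega> - \<mu>)))
      \<le> (H - lam / \<beta> * \<psi> \<mu>) + lam / \<beta> * \<psi> (Y \<omega>) + H * K_const p / \<beta> * U \<omega> + H * c * Q \<omega>"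
      by (simp add: W_def)
  next
    have "cosh (norm (x + (lam / \<beta>) *\<^sub>R (T \<omega> - \<mu>))) \<le> cosh (norm x + 2 / \<beta>)" for \<omega>
      using W_le[of \<omega>] norm_triangle_ineq[of x "(lam / \<beta>) *\<^sub>R (T \<omega> - \<mu>)"]
      by (intro cosh_mono_nonneg) auto
    then have "integrable M (\<lambda>\<omega>. cosh (norm (x + (lam / \<beta>) *\<^sub>R (T \<omega> - \<mu>))))"
      by (intro integrable_const_bound[where B = "cosh (norm x + 2 / \<beta>)"]) 
         (auto intro!: borel_measurable_continuous_on[of cosh] continuous_intros)
    then show "set_integrable M A (\<lambda>\<omega>. cosh (norm (x + (lam / \<beta>) *\<^sub>R (T \<omega> - \<mu>))))"
      by (rule si)
  qed (intro si Bochner_Integration.integrable_add integrable_mult_right \<psi>_int U_int Q_int integrable_const)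
  also have "\<dots> = (H - lam / \<beta> * \<psi> \<mu>) * measure M A + lam / \<beta> * (LINT \<omega>:A|M. \<psi> (Y \<omega>))
       + H * K_const p / \<beta> * (LINT \<omega>:A|M. U \<omega>) + H * c * (LINT \<omega>:A|M. Q \<omega>)"
  proof -
    have "(LINT \<omega>:A|M. (H - lam / \<beta> * \<psi> \<mu>) + lam / \<beta> * \<psi> (Y \<omega>) + H * K_const p / \<beta> * U \<omega> + H * c * Q \<omega>)
       = (LINT \<omega>:A|M. (H - lam / \<beta> * \<psi> \<mu>) + lam / \<beta> * \<psi> (Y \<omega>) + H * K_const p / \<beta> * U \<omega>)
         + (LINT \<omega>:A|M. H * c * Q \<omega>)"
      by (intro set_integral_add(2) si Bochner_Integration.integrable_add integrable_mult_right
          integrable_const \<psi>_int U_int Q_int)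
    then show ?thesis
      by (simp only: set_integral_affine[OF \<psi>_int U_int AM] set_integral_mult_right)
  qed
  also have "\<dots> = H * measure M A
       + H * K_const p / \<beta> * (LINT \<omega>:A|M. U \<omega>) + H * c * (LINT \<omega>:A|M. Q \<omega>)"
    by (simp add: set_integral_bounded_linear[OF bl A] algebra_simps)
  also have "\<dots> \<le> H * measure M A + H * K_const p / \<beta> * (lam powr p * v * measure M A)
      + H * c * ((if is_hilbert TYPE('b) then 2 else 4) * (lam powr p * v) * measure M A)"
    unfolding U_def Q_def
    using set_integral_scaled_moment[OF A] set_integral_sq_le[OF A] H c \<beta> K_const_nonneg[OF p(1)]
    by (intro add_mono mult_left_mono order_refl) auto
  also have "\<dots> = (1 + growth p v lam \<beta> TYPE('b)) * H * measure M A"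
    unfolding growth_def c_def[symmetric] by (simp add: algebra_simps)
  finally show ?thesis by (simp add: H_def)
qed

end

section \<open>Supermartingale and maximal inequality\<close>

lemma borel_measurable_cosh [measurable (raw)]:
  fixes f :: "'a \<Rightarrow> real"
  assumes "f \<in> borel_measurable M"
  shows "(\<lambda>\<omega>. cosh (f \<omega>)) \<in> borel_measurable M"
  by (rule borel_measurable_continuous_on[OF _ assms]) (intro continuous_intros)

context prob_space
begin

text \<open>A simple past position is constant on finitely many sets of G, and the one-step bound
  for deterministic x applies on each of them.\<close>

lemma set_integral_cosh_simple:
  fixes W s :: "'a \<Rightarrow> 'b::{banach, second_countable_topology}"
  assumes sub: "subalgebra M G"
    and W [measurable]: "W \<in> borel_measurable M" and W_bdd: "\<And>\<omega>. norm (W \<omega>) \<le> w"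
    and s: "simple_function G s"
    and step: "\<And>x A. A \<in> sets G \<Longrightarrow>
        (LINT \<omega>:A|M. cosh (norm (x + W \<omega>))) \<le> g * cosh (norm x) * measure M A"
    and A: "A \<in> sets G"
  shows "(LINT \<omega>:A|M. cosh (norm (s \<omega> + W \<omega>))) \<le> g * (LINT \<omega>:A|M. cosh (norm (s \<omega>)))"
proof -
  have sp: "space G = space M" and GM: "\<And>B. B \<in> sets G \<Longrightarrow> B \<in> sets M"
    using sub by (auto simp: subalgebra_def)
  define R where "R = s ` space M"
  define B where "B x = A \<inter> (s -` {x} \<inter> space M)" for x
  have R: "finite R" using s by (simp add: R_def simple_function_def sp)
  have BG: "B x \<in> sets G" if "x \<in> R" for x
    using s A that by (auto simp: B_def R_def simple_function_def sp)
  have BM: "B x \<in> sets M" if "x \<in> R" for x using BG[OF that] by (rule GM)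
  have split: "indicator A \<omega> *\<^sub>R f (s \<omega>) \<omega> = (\<Sum>x\<in>R. indicator (B x) \<omega> *\<^sub>R f x \<omega>)"
    if \<omega>: "\<omega> \<in> space M" for f :: "'b \<Rightarrow> 'a \<Rightarrow> real" and \<omega>
  proof -
    have "(\<Sum>x\<in>R. indicator (B x) \<omega> *\<^sub>R f x \<omega>) = (\<Sum>x\<in>R. if x = s \<omega> then indicator A \<omega> *\<^sub>R f x \<omega> else 0)"
      using \<omega> by (intro sum.cong) (auto simp: B_def indicator_def)
    also have "\<dots> = indicator A \<omega> *\<^sub>R f (s \<omega>) \<omega>"
      using R \<omega> by (simp add: R_def)
    finally show ?thesis by simp
  qed
  have split_int: "(LINT \<omega>:A|M. f (s \<omega>) \<omega>) = (\<Sum>x\<in>R. LINT \<omega>:B x|M. f x \<omega>)"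
    if f: "\<And>x. integrable M (f x)" for f :: "'b \<Rightarrow> 'a \<Rightarrow> real"
  proof -
    have "(LINT \<omega>:A|M. f (s \<omega>) \<omega>) = (LINT \<omega>|M. (\<Sum>x\<in>R. indicator (B x) \<omega> *\<^sub>R f x \<omega>))"
      unfolding set_lebesgue_integral_def by (intro Bochner_Integration.integral_cong refl split)
    also have "\<dots> = (\<Sum>x\<in>R. LINT \<omega>:B x|M. f x \<omega>)"
      unfolding set_lebesgue_integral_def
      by (intro Bochner_Integration.integral_sum integrable_mult_indicator BM f)
    finally show ?thesis .
  qed
  have int: "integrable M (\<lambda>\<omega>. cosh (norm (x + W \<omega>)))" for x
  proof (rule integrable_const_bound[where B = "cosh (norm x + w)"])
    have "cosh (norm (x + W \<omega>)) \<le> cosh (norm x + w)" for \<omega>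
      using norm_triangle_ineq[of x "W \<omega>"] W_bdd[of \<omega>] by (intro cosh_mono_nonneg) auto
    then show "AE \<omega> in M. norm (cosh (norm (x + W \<omega>))) \<le> cosh (norm x + w)" by simp
  qed measurable
  have "(LINT \<omega>:A|M. cosh (norm (s \<omega> + W \<omega>))) = (\<Sum>x\<in>R. LINT \<omega>:B x|M. cosh (norm (x + W \<omega>)))"
    by (rule split_int[OF int])
  also have "\<dots> \<le> (\<Sum>x\<in>R. g * cosh (norm x) * measure M (B x))"
    by (intro sum_mono step BG)
  also have "\<dots> = g * (\<Sum>x\<in>R. LINT \<omega>:B x|M. cosh (norm x))"
    using BM by (simp add: sum_distrib_left set_integral_const emeasure_eq_measure mult_ac)
  also have "\<dots> = g * (LINT \<omega>:A|M. cosh (norm (s \<omega>)))"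
    by (subst split_int[of "\<lambda>x _. cosh (norm x)"]) auto
  finally show ?thesis .
qed

text \<open>Boundedness of S and W lets dominated convergence pass from simple positions to S on
  both sides.\<close>

lemma set_integral_cosh_bounded:
  fixes W S :: "'a \<Rightarrow> 'b::{banach, second_countable_topology}"
  assumes sub: "subalgebra M G"
    and W [measurable]: "W \<in> borel_measurable M" and W_bdd: "\<And>\<omega>. norm (W \<omega>) \<le> w"
    and S: "S \<in> borel_measurable G" and S_bdd: "\<And>\<omega>. norm (S \<omega>) \<le> b"
    and step: "\<And>x A. A \<in> sets G \<Longrightarrow>
        (LINT \<omega>:A|M. cosh (norm (x + W \<omega>))) \<le> g * cosh (norm x) * measure M A"
    and A: "A \<in> sets G"
  shows "(LINT \<omega>:A|M. cosh (norm (S \<omega> + W \<omega>))) \<le> g * (LINT \<omega>:A|M. cosh (norm (S \<omega>)))"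
proof -
  have sp: "space G = space M" and GM: "\<And>B. B \<in> sets G \<Longrightarrow> B \<in> sets M"
    using sub by (auto simp: subalgebra_def)
  have [measurable]: "A \<in> sets M" using A by (rule GM)
  have [measurable]: "S \<in> borel_measurable M" by (rule measurable_from_subalg[OF sub S])
  obtain s where s: "\<And>i. simple_function G (s i)"
    and lim: "\<And>\<omega>. \<omega> \<in> space G \<Longrightarrow> (\<lambda>i. s i \<omega>) \<longlonglongrightarrow> S \<omega>"
    and bdd: "\<And>i \<omega>. \<omega> \<in> space G \<Longrightarrow> norm (s i \<omega>) \<le> 2 * norm (S \<omega>)"
  proof -
    obtain s where "\<forall>i. simple_function G (s i)" "\<forall>\<omega>\<in>space G. (\<lambda>i. s i \<omega>) \<longlonglongrightarrow> S \<omega>"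
        "\<forall>i. \<forall>\<omega>\<in>space G. dist (s i \<omega>) 0 \<le> 2 * dist (S \<omega>) 0"
      using borel_measurable_implies_sequence_metric[OF S, of 0] by blast
    then show ?thesis by (intro that[of s]) auto
  qed
  have [measurable]: "s i \<in> borel_measurable M" for i
    by (rule measurable_from_subalg[OF sub borel_measurable_simple_function[OF s]])
  have conv: "(\<lambda>i. LINT \<omega>:A|M. cosh (norm (s i \<omega> + V \<omega>))) \<longlonglongrightarrow> (LINT \<omega>:A|M. cosh (norm (S \<omega> + V \<omega>)))"
    if V [measurable]: "V \<in> borel_measurable M" and V_bdd: "\<And>\<omega>. norm (V \<omega>) \<le> w'" for V :: "'a \<Rightarrow> 'b" and w'
    unfolding set_lebesgue_integral_def
  \<comment> \<open>The approximants are bounded only by twice the norm of S, hence 2 * b.\<close>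
  proof (rule integral_dominated_convergence[where w = "\<lambda>_. cosh (2 * b + w')"])
    show "AE \<omega> in M. (\<lambda>i. indicator A \<omega> *\<^sub>R cosh (norm (s i \<omega> + V \<omega>)))
        \<longlonglongrightarrow> indicator A \<omega> *\<^sub>R cosh (norm (S \<omega> + V \<omega>))"
      using lim sp by (intro AE_I2 tendsto_intros) auto
    show "AE \<omega> in M. norm (indicator A \<omega> *\<^sub>R cosh (norm (s i \<omega> + V \<omega>))) \<le> cosh (2 * b + w')" for i
    proof (rule AE_I2)
      fix \<omega> assume "\<omega> \<in> space M"
      then have "norm (s i \<omega> + V \<omega>) \<le> 2 * b + w'"
        using bdd[of \<omega> i] S_bdd[of \<omega>] V_bdd[of \<omega>] norm_triangle_ineq[of "s i \<omega>" "V \<omega>"] sp by simp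
      then have "cosh (norm (s i \<omega> + V \<omega>)) \<le> cosh (2 * b + w')" by (intro cosh_mono_nonneg) auto
      then show "norm (indicator A \<omega> *\<^sub>R cosh (norm (s i \<omega> + V \<omega>))) \<le> cosh (2 * b + w')"
        by (simp add: indicator_def)
    qed
  qed (auto intro!: borel_measurable_scaleR)
  show ?thesis
  proof (rule LIMSEQ_le)
    show "(\<lambda>i. LINT \<omega>:A|M. cosh (norm (s i \<omega> + W \<omega>))) \<longlonglongrightarrow> (LINT \<omega>:A|M. cosh (norm (S \<omega> + W \<omega>)))"
      by (rule conv[OF W W_bdd])
    show "(\<lambda>i. g * (LINT \<omega>:A|M. cosh (norm (s i \<omega>)))) \<longlonglongrightarrow> g * (LINT \<omega>:A|M. cosh (norm (S \<omega>)))"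
      using conv[of "\<lambda>_. 0" 0] by (intro tendsto_mult_left) simp
    show "\<exists>N. \<forall>i\<ge>N. (LINT \<omega>:A|M. cosh (norm (s i \<omega> + W \<omega>))) \<le> g * (LINT \<omega>:A|M. cosh (norm (s i \<omega>)))"
      using set_integral_cosh_simple[OF sub W W_bdd s step A] by blast
  qed
qed

text \<open>Markov's inequality on the part of A where f \<ge> c, with the integral over the rest
  retained for the next step.\<close>

lemma set_integral_ge_split:
  fixes f :: "'a \<Rightarrow> real"
  assumes f: "integrable M f" and A: "A \<in> sets M"
  shows "(LINT \<omega>:{\<omega>\<in>A. f \<omega> < c}|M. f \<omega>) + c * (measure M A - measure M {\<omega>\<in>A. f \<omega> < c})
      \<le> (LINT \<omega>:A|M. f \<omega>)"
proof -
  have [measurable]: "f \<in> borel_measurable M" using f by auto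
  define B where "B = {\<omega>\<in>A. f \<omega> < c}"
  have B: "B \<in> sets M" 
  proof -
    have "B = A \<inter> {\<omega>\<in>space M. f \<omega> < c}" using sets.sets_into_space[OF A] by (auto simp: B_def)
    then show ?thesis using A by simp
  qed
  have BA: "B \<subseteq> A" by (auto simp: B_def)
  note si = integrable_imp_set_integrable[OF f]
  have "(LINT \<omega>:A|M. f \<omega>) = (LINT \<omega>:B|M. f \<omega>) + (LINT \<omega>:A - B|M. f \<omega>)"
    using set_integral_Un[of B "A - B" M f] si A B BA by (simp add: Un_absorb1)
  moreover have "(LINT \<omega>:A - B|M. c) \<le> (LINT \<omega>:A - B|M. f \<omega>)"
    using A B by (intro set_integral_mono si integrable_imp_set_integrable) (auto simp: B_def)
  moreover have "(LINT \<omega>:A - B|M. c) = c * (measure M A - measure M B)"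
    using A B BA by (simp add: set_integral_const emeasure_eq_measure finite_measure_Diff)
  ultimately show ?thesis by (simp add: B_def)
qed

text \<open>The sets B n of paths below the level up to time n replace a stopping time: each B n
  lies in F n, so the supermartingale inequality applies on it.\<close>

lemma ville_inequality:
  fixes U :: "nat \<Rightarrow> 'a \<Rightarrow> real"
  assumes sub: "\<And>n. subalgebra M (F n)"
    and filt: "\<And>i j. i \<le> j \<Longrightarrow> sets (F i) \<subseteq> sets (F j)"
    and adapted: "\<And>n. U n \<in> borel_measurable (F n)"
    and int: "\<And>n. integrable M (U n)"
    and nonneg: "\<And>n \<omega>. 0 \<le> U n \<omega>"
    and start: "(LINT \<omega>|M. U 0 \<omega>) \<le> 1"
    and super: "\<And>n A. A \<in> sets (F n) \<Longrightarrow> (LINT \<omega>:A|M. U (Suc n) \<omega>) \<le> (LINT \<omega>:A|M. U n \<omega>)"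
    and \<delta>: "0 < \<delta>"
  shows "\<exists>B\<in>sets M. 1 - \<delta> \<le> measure M B \<and> (\<forall>\<omega>\<in>B. \<forall>n. U n \<omega> < 1 / \<delta>)"
proof -
  have sp: "space (F n) = space M" and FM: "A \<in> sets (F n) \<Longrightarrow> A \<in> sets M" for n A
    using sub[of n] by (auto simp: subalgebra_def)
  define c where "c = 1 / \<delta>"
  have c: "0 < c" using \<delta> by (simp add: c_def)
  define B where "B n = {\<omega>\<in>space M. \<forall>j\<le>n. U j \<omega> < c}" for n
  have B0: "B 0 = {\<omega>\<in>space M. U 0 \<omega> < c}" by (auto simp: B_def)
  have BSuc: "B (Suc n) = {\<omega>\<in>B n. U (Suc n) \<omega> < c}" for n
    by (auto simp: B_def le_Suc_eq)
  have U_lt: "{\<omega>\<in>space M. U n \<omega> < c} \<in> sets (F n)" for n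
    using adapted[of n] sp[of n] by (auto simp: borel_measurable_iff_less)
  have BF: "B n \<in> sets (F n)" for n
  proof (induction n)
    case 0
    then show ?case using U_lt[of 0] by (simp add: B0)
  next
    case (Suc n)
    have "B (Suc n) = B n \<inter> {\<omega>\<in>space M. U (Suc n) \<omega> < c}"
      unfolding BSuc by (auto simp: B_def)
    then show ?case using Suc filt[of n "Suc n"] U_lt[of "Suc n"] by auto
  qed
  have BM: "B n \<in> sets M" for n using BF by (rule FM)
  \<comment> \<open>The stopped process in disguise: surviving paths keep their integral, and
    departed ones are charged c times their probability.\<close>
  have inv: "(LINT \<omega>:B n|M. U n \<omega>) + c * (1 - measure M (B n)) \<le> 1" for n
  proof (induction n)
    case 0
    show ?case
      using set_integral_ge_split[OF int[of 0] sets.top, of c] start int[of 0]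
      by (simp add: B0 set_integral_space prob_space)
  next
    case (Suc n)
    have "(LINT \<omega>:B (Suc n)|M. U (Suc n) \<omega>) + c * (measure M (B n) - measure M (B (Suc n)))
        \<le> (LINT \<omega>:B n|M. U (Suc n) \<omega>)"
      using set_integral_ge_split[OF int[of "Suc n"] BM[of n], of c] by (simp add: BSuc)
    also have "\<dots> \<le> (LINT \<omega>:B n|M. U n \<omega>)" by (rule super[OF BF])
    finally show ?case using Suc by (simp add: algebra_simps)
  qed
  have ge: "1 - \<delta> \<le> measure M (B n)" for n
  proof -
    have "0 \<le> (LINT \<omega>:B n|M. U n \<omega>)"
      unfolding set_lebesgue_integral_def using nonneg by (intro integral_nonneg_AE) auto
    then have "c * (1 - measure M (B n)) \<le> 1" using inv[of n] by simp
    then show ?thesis using \<delta> by (simp add: c_def field_simps)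
  qed
  have dec: "decseq B" by (auto simp: decseq_def B_def)
  have "(\<lambda>n. measure M (B n)) \<longlonglongrightarrow> measure M (\<Inter>n. B n)"
    by (rule finite_Lim_measure_decseq) (use BM dec in auto)
  then have "1 - \<delta> \<le> measure M (\<Inter>n. B n)"
    by (rule LIMSEQ_le_const) (use ge in auto)
  moreover have "(\<Inter>n. B n) \<in> sets M" using BM by auto
  moreover have "\<forall>\<omega>\<in>(\<Inter>n. B n). \<forall>n. U n \<omega> < 1 / \<delta>"
    by (auto simp: B_def c_def)
  ultimately show ?thesis by blast
qed

end

section \<open>Concentration of the truncated mean\<close>

abbreviation (input) rate_const :: "real \<Rightarrow> real \<Rightarrow> 'b::real_normed_vector itself \<Rightarrow> real" where
  "rate_const p \<beta> B \<equiv> \<beta> * C_const p \<beta> B + K_const p * 2 powr (p - 1)"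

locale heavy_tailed_sequence = prob_space M for M :: "'a measure" +
  fixes F :: "nat \<Rightarrow> 'a measure"
    and X :: "nat \<Rightarrow> 'a \<Rightarrow> 'b::{banach, second_countable_topology}"
    and \<mu> :: 'b and \<beta> p v \<delta> :: real
  assumes smooth: "beta_smooth \<beta> TYPE('b)" and beta_pos: "\<beta> > 0"
    and filt_sub: "\<And>n. subalgebra M (F n)"
    and filt_mono: "\<And>i j. i \<le> j \<Longrightarrow> sets (F i) \<subseteq> sets (F j)"
    and adapted: "\<And>n. n \<ge> 1 \<Longrightarrow> X n \<in> borel_measurable (F n)"
    and mean: "\<And>n. n \<ge> 1 \<Longrightarrow> cond_exp_is_const M (F (n - 1)) (X n) \<mu>"
    and moment: "\<And>n. n \<ge> 1 \<Longrightarrow>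
        AE \<omega> in M. nn_cond_exp M (F (n - 1)) (\<lambda>\<omega>. ennreal (norm (X n \<omega>) powr p)) \<omega> \<le> ennreal v"
    and p: "1 < p" "p \<le> 2"
    and v: "v > 0"
    and \<delta>: "0 < \<delta>" "\<delta> \<le> 1"
begin

lemma bounded_moment_X: "bounded_moment M (F n) (X (Suc n)) \<mu> p v"
  using filt_sub[of n] measurable_from_subalg[OF filt_sub adapted, of "Suc n"] mean[of "Suc n"]
    moment[of "Suc n"] p v
  by unfold_locales auto

lemma truncated_step_X:
  assumes "0 < lam" "lam powr p * v \<le> 1"
  shows "truncated_step M (F n) (X (Suc n)) \<mu> p v lam"
  using bounded_moment_X assms by (intro truncated_step.intro truncated_step_axioms.intro)

section \<open>Positivity and comparison of the constants\<close>

lemma exp_coeff_ge_half: "1 / 2 \<le> (exp (2 / \<beta>) - 2 / \<beta> - 1) / (2 / \<beta>)\<^sup>2"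
  using beta_pos by (intro exp_remainder_coeff_ge_half) auto

lemma exp_coeff_nonneg: "0 \<le> (exp (2 / \<beta>) - 2 / \<beta> - 1) / (2 / \<beta>)\<^sup>2"
  by (rule order_trans[OF _ exp_coeff_ge_half]) simp

lemma two_powr_ge_1: "1 \<le> (2::real) powr (p - 1)"
  using p by (intro ge_one_powr_ge_zero) auto

lemma two_powr_plus_1: "(2::real) powr (p + 1) = 4 * 2 powr (p - 1)"
  using powr_add[of "2::real" "p - 1" 2] by (simp add: ac_simps)

lemma C_const_ge_half: "1 / 2 \<le> C_const p \<beta> TYPE('b)"
proof -
  have "1 \<le> (if is_hilbert TYPE('b) then 2 powr (p - 1) else 2 powr (p + 1) :: real)"
    using two_powr_ge_1 two_powr_plus_1 by simp
  from mult_mono[OF this exp_coeff_ge_half] show ?thesis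
    by (simp add: C_const_def)
qed

lemma rate_const_pos: "0 < rate_const p \<beta> TYPE('b)"
proof -
  have "0 < \<beta> * C_const p \<beta> TYPE('b)"
    using C_const_ge_half beta_pos by (intro mult_pos_pos) auto
  moreover have "0 \<le> K_const p * 2 powr (p - 1)"
    using K_const_nonneg p by simp
  ultimately show ?thesis by simp
qed

lemma ln_pos: "0 < ln (2 / \<delta>)"
  using \<delta> by (intro ln_gt_zero) (simp add: field_simps)

text \<open>The drift has room to spare: its factors 2 or 4 face 2 powr p or 2 powr (p + 2) on the
  right, and \<open>K_const p\<close> gains a factor 2 powr p.\<close>

lemma growth_le:
  assumes lam: "0 < lam"
  shows "\<beta> / lam * growth p v lam \<beta> TYPE('b) \<le> 2 * v * lam powr (p - 1) * rate_const p \<beta> TYPE('b)"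
proof -
  define c where "c = (exp (2 / \<beta>) - 2 / \<beta> - 1) / (2 / \<beta>)\<^sup>2"
  define k :: real where "k = (if is_hilbert TYPE('b) then 2 else 4)"
  define h :: real where "h = (if is_hilbert TYPE('b) then 2 powr (p - 1) else 2 powr (p + 1))"
  have c: "0 \<le> c" unfolding c_def by (rule exp_coeff_nonneg)
  have "k \<le> 2 * h"
    using two_powr_ge_1 two_powr_plus_1 by (simp add: k_def h_def)
  then have "\<beta> * (k * c) \<le> \<beta> * (2 * h * c)"
    using c beta_pos by (intro mult_left_mono mult_right_mono) auto
  moreover have "K_const p * 1 \<le> K_const p * (2 * 2 powr (p - 1))"
    using K_const_nonneg[OF p(1)] two_powr_ge_1 by (intro mult_left_mono) auto
  ultimately have le: "K_const p + \<beta> * (k * c) \<le> 2 * rate_const p \<beta> TYPE('b)"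
    by (simp add: C_const_def c_def[symmetric] h_def[symmetric])
  have "lam powr p = lam * lam powr (p - 1)"
    using lam powr_add[of lam 1 "p - 1"] by simp
  then have "\<beta> / lam * growth p v lam \<beta> TYPE('b) = v * lam powr (p - 1) * (K_const p + \<beta> * (k * c))"
    unfolding growth_def c_def[symmetric] k_def[symmetric]
    using lam beta_pos by (simp add: field_simps)
  also have "\<dots> \<le> v * lam powr (p - 1) * (2 * rate_const p \<beta> TYPE('b))"
    using le v by (intro mult_left_mono) auto
  also have "\<dots> = 2 * v * lam powr (p - 1) * rate_const p \<beta> TYPE('b)"
    by (simp only: mult_ac)
  finally show ?thesis .
qed

lemma growth_nonneg: "0 \<le> growth p v lam \<beta> TYPE('b)"
  unfolding growth_def using exp_coeff_nonneg K_const_nonneg[OF p(1)] beta_pos v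
  by (intro mult_nonneg_nonneg add_nonneg_nonneg) auto

lemma uniform_bound_small:
  assumes lam: "0 < lam" and small: "lam powr p * v \<le> 1"
  shows "\<exists>B\<in>sets M. 1 - \<delta> \<le> measure M B \<and> (\<forall>\<omega>\<in>B. \<forall>n\<ge>1.
    norm (mu_hat X lam n \<omega> - \<mu>)
      \<le> \<beta> / lam * growth p v lam \<beta> TYPE('b) + \<beta> * ln (2 / \<delta>) / (lam * real n))"
proof -
  define g where "g = growth p v lam \<beta> TYPE('b)"
  define W where "W m \<omega> = (lam / \<beta>) *\<^sub>R (Trunc (lam *\<^sub>R X m \<omega>) *\<^sub>R X m \<omega> - \<mu>)" for m \<omega>
  define S where "S n \<omega> = (\<Sum>m = 1..n. W m \<omega>)" for n \<omega>
  \<comment> \<open>The geometric normalisation removes the drift; U 0 is cosh 0 = 1.\<close>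
  define U where "U n \<omega> = cosh (norm (S n \<omega>)) / (1 + g) ^ n" for n \<omega>
  have g: "0 \<le> g" unfolding g_def by (rule growth_nonneg)
  have X_meas: "X m \<in> borel_measurable (F n)" if "1 \<le> m" "m \<le> n" for m n
  proof -
    have "subalgebra (F n) (F m)"
      using filt_sub[of n] filt_sub[of m] filt_mono[OF that(2)] by (simp add: subalgebra_def)
    then show ?thesis by (rule measurable_from_subalg) (rule adapted[OF that(1)])
  qed
  have W_meas_F: "W m \<in> borel_measurable (F n)" if "1 \<le> m" "m \<le> n" for m n
  proof -
    have [measurable]: "X m \<in> borel_measurable (F n)" by (rule X_meas[OF that])
    show ?thesis unfolding W_def by measurable
  qed
  have S_meas: "S n \<in> borel_measurable (F n)" for n
    unfolding S_def by (intro borel_measurable_sum W_meas_F) auto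
  have S_meas_M [measurable]: "S n \<in> borel_measurable M" for n
    by (rule measurable_from_subalg[OF filt_sub S_meas])
  have W_bdd: "norm (W (Suc m) \<omega>) \<le> 2 / \<beta>" for m \<omega>
  proof -
    interpret truncated_step M "F m" "X (Suc m)" \<mu> p v lam
      by (rule truncated_step_X[OF lam small])
    show ?thesis
      using scaled_norm_diff_le_2[of \<omega>] lam beta_pos by (simp add: W_def T_def divide_right_mono)
  qed
  have S_bdd: "norm (S n \<omega>) \<le> real n * (2 / \<beta>)" for n \<omega>
  proof -
    have "norm (S n \<omega>) \<le> (\<Sum>m = 1..n. norm (W m \<omega>))"
      unfolding S_def by (rule norm_sum)
    also have "\<dots> \<le> (\<Sum>m = 1..n. 2 / \<beta>)"
    proof (rule sum_mono)
      fix m assume "m \<in> {1..n}"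
      then show "norm (W m \<omega>) \<le> 2 / \<beta>" using W_bdd[of "m - 1" \<omega>] by simp
    qed
    finally show ?thesis by simp
  qed
  have cosh_int: "integrable M (\<lambda>\<omega>. cosh (norm (S n \<omega>)))" for n
    by (rule integrable_const_bound[where B = "cosh (real n * (2 / \<beta>))"])
       (use S_bdd in \<open>auto intro!: cosh_mono_nonneg\<close>)
  have super: "(LINT \<omega>:A|M. U (Suc n) \<omega>) \<le> (LINT \<omega>:A|M. U n \<omega>)" if A: "A \<in> sets (F n)" for n A
  proof -
    interpret step: truncated_step M "F n" "X (Suc n)" \<mu> p v lam
      by (rule truncated_step_X[OF lam small])
    have "(LINT \<omega>:A|M. cosh (norm (S n \<omega> + W (Suc n) \<omega>))) \<le> (1 + g) * (LINT \<omega>:A|M. cosh (norm (S n \<omega>)))"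
    proof (rule set_integral_cosh_bounded[OF filt_sub _ W_bdd S_meas S_bdd _ A])
      show "W (Suc n) \<in> borel_measurable M"
        using measurable_from_subalg[OF filt_sub W_meas_F, of "Suc n" "Suc n"] by simp
      show "(LINT \<omega>:A|M. cosh (norm (x + W (Suc n) \<omega>))) \<le> (1 + g) * cosh (norm x) * measure M A"
        if "A \<in> sets (F n)" for x A
        using step.set_integral_cosh_step[OF smooth beta_pos that, of x]
        by (simp add: W_def g_def step.T_def)
    qed
    then have "(LINT \<omega>:A|M. cosh (norm (S (Suc n) \<omega>))) / (1 + g) ^ Suc n
        \<le> (1 + g) * (LINT \<omega>:A|M. cosh (norm (S n \<omega>))) / (1 + g) ^ Suc n"
      using g by (intro divide_right_mono) (auto simp: S_def)
    also have "\<dots> = (LINT \<omega>:A|M. cosh (norm (S n \<omega>))) / (1 + g) ^ n"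
      using g by simp
    finally show ?thesis by (simp only: U_def set_integral_divide_zero)
  qed
  have "\<exists>B\<in>sets M. 1 - \<delta> \<le> measure M B \<and> (\<forall>\<omega>\<in>B. \<forall>n. U n \<omega> < 1 / \<delta>)"
  proof (rule ville_inequality[OF filt_sub filt_mono])
    show "U n \<in> borel_measurable (F n)" for n
      unfolding U_def using S_meas[of n] by measurable
    show "integrable M (U n)" for n
      unfolding U_def using cosh_int by simp
    show "0 \<le> U n \<omega>" for n \<omega> using g by (simp add: U_def)
    show "(LINT \<omega>|M. U 0 \<omega>) \<le> 1" by (simp add: U_def S_def prob_space)
  qed (use super \<delta> in auto)
  then obtain B where B: "B \<in> sets M" "1 - \<delta> \<le> measure M B" and U_lt: "\<And>\<omega> n. \<omega> \<in> B \<Longrightarrow> U n \<omega> < 1 / \<delta>"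
    by blast
  have "norm (mu_hat X lam n \<omega> - \<mu>) \<le> \<beta> / lam * g + \<beta> * ln (2 / \<delta>) / (lam * real n)"
    if \<omega>: "\<omega> \<in> B" and n: "1 \<le> n" for \<omega> n
  proof -
    have "exp (norm (S n \<omega>)) / 2 \<le> cosh (norm (S n \<omega>))"
      by (simp add: cosh_field_def)
    also have "\<dots> < 1 / \<delta> * (1 + g) ^ n"
      using U_lt[OF \<omega>, of n] g by (simp add: U_def pos_divide_less_eq)
    \<comment> \<open>1 + g \<le> exp g makes the accumulated drift linear in n after taking
      logarithms.\<close>
    also have "\<dots> \<le> 1 / \<delta> * exp g ^ n"
      using g \<delta> by (intro mult_left_mono power_mono) auto
    finally have "exp (norm (S n \<omega>)) < 2 / \<delta> * exp (real n * g)"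
      unfolding exp_of_nat_mult by (simp add: mult_ac)
    also have "\<dots> = exp (ln (2 / \<delta>) + real n * g)"
      using \<delta> by (simp add: exp_add)
    finally have S_le: "norm (S n \<omega>) \<le> ln (2 / \<delta>) + real n * g" by simp
    have "mu_hat X lam n \<omega> - \<mu> = (1 / real n) *\<^sub>R (\<Sum>m = 1..n. Trunc (lam *\<^sub>R X m \<omega>) *\<^sub>R X m \<omega> - \<mu>)"
      using n by (simp add: mu_hat_def sum_subtractf scaleR_diff_right sum_constant_scaleR)
    also have "\<dots> = (\<beta> / (lam * real n)) *\<^sub>R S n \<omega>"
      using lam beta_pos by (simp add: S_def W_def flip: scaleR_right.sum)
    finally have "norm (mu_hat X lam n \<omega> - \<mu>) = \<beta> / (lam * real n) * norm (S n \<omega>)"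
      using lam beta_pos by simp
    also have "\<dots> \<le> \<beta> / (lam * real n) * (ln (2 / \<delta>) + real n * g)"
      using S_le lam beta_pos by (intro mult_left_mono) auto
    also have "\<dots> = \<beta> / lam * g + \<beta> * ln (2 / \<delta>) / (lam * real n)"
      using lam n by (simp add: field_simps)
    finally show ?thesis .
  qed
  then show ?thesis using B unfolding g_def by blast
qed

text \<open>Smoothness at x = 0. The nonzero vector matters, since the zero space is \<beta>-smooth
  for every \<beta>.\<close>

lemma beta_ge_1:
  fixes y :: 'b
  assumes "y \<noteq> 0"
  shows "1 \<le> \<beta>"
proof -
  have "(norm (0 + y))\<^sup>2 + (norm (0 - y))\<^sup>2 \<le> 2 * (norm (0::'b))\<^sup>2 + 2 * \<beta>\<^sup>2 * (norm y)\<^sup>2"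
    using smooth unfolding beta_smooth_def by blast
  then have "1\<^sup>2 \<le> \<beta>\<^sup>2" using assms by simp
  then show ?thesis by (rule power2_le_imp_le) (use beta_pos in simp)
qed

text \<open>Both lam * norm (mu_hat) \<le> 1 and lam * norm \<mu> are at most a = lam powr p * v, so
  the deviation is at most 2 a / lam surely, and the rate constant is at least 1.\<close>

lemma bound_large:
  assumes lam: "0 < lam" and large: "1 \<le> lam powr p * v" and \<beta>: "1 \<le> \<beta>"
  shows "norm (mu_hat X lam n \<omega> - \<mu>) \<le> 2 * v * lam powr (p - 1) * rate_const p \<beta> TYPE('b)"
proof -
  define a where "a = lam powr p * v"
  interpret bounded_moment M "F 0" "X (Suc 0)" \<mu> p v by (rule bounded_moment_X)
  \<comment> \<open>Otherwise lam * norm \<mu> exceeds a \<ge> 1, so its p-th power, which is at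
    most a, would be at least as large as itself.\<close>
  have "lam * norm \<mu> \<le> a"
  proof (rule ccontr)
    assume "\<not> ?thesis"
    then have gt: "a < lam * norm \<mu>" by simp
    then have "(lam * norm \<mu>) powr 1 \<le> (lam * norm \<mu>) powr p"
      using large p by (intro powr_mono) (auto simp: a_def)
    also have "\<dots> \<le> a"
      using norm_mean_powr_le lam by (simp add: powr_mult a_def)
    finally show False using gt by simp
  qed
  moreover have "lam * norm (mu_hat X lam n \<omega>) \<le> 1"
  proof -
    have "lam * norm (mu_hat X lam n \<omega>)
        = 1 / real n * (lam * norm (\<Sum>m = 1..n. Trunc (lam *\<^sub>R X m \<omega>) *\<^sub>R X m \<omega>))"
      by (simp add: mu_hat_def)
    also have "\<dots> \<le> 1 / real n * (\<Sum>m = 1..n. lam * norm (Trunc (lam *\<^sub>R X m \<omega>) *\<^sub>R X m \<omega>))"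
      unfolding sum_distrib_left[symmetric] using lam by (intro mult_left_mono norm_sum) auto
    also have "\<dots> \<le> 1 / real n * (\<Sum>m = 1..n. 1)"
      unfolding norm_Trunc_scaleR[OF lam] by (intro mult_left_mono sum_mono) auto
    also have "\<dots> \<le> 1" by simp
    finally show ?thesis .
  qed
  moreover have "lam * norm (mu_hat X lam n \<omega> - \<mu>) \<le> lam * (norm (mu_hat X lam n \<omega>) + norm \<mu>)"
    using lam by (intro mult_left_mono norm_triangle_ineq4) auto
  ultimately have "lam * norm (mu_hat X lam n \<omega> - \<mu>) \<le> 2 * a"
    using large by (simp add: a_def distrib_left)
  \<comment> \<open>Each summand of the rate constant is at least 1/2: the first through \<beta>
    \<ge> 1, the second through \<open>K_const_ge\<close>.\<close>
  also have "\<dots> \<le> 2 * rate_const p \<beta> TYPE('b) * a"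
  proof -
    have "1 * (1 / 2) \<le> \<beta> * C_const p \<beta> TYPE('b)"
      using \<beta> C_const_ge_half by (intro mult_mono) auto
    moreover have "2 * (K_const p * 2 powr (p - 1)) \<ge> 1"
      using K_const_ge[OF p(1)] powr_add[of "2::real" "p - 1" 1] by simp
    ultimately have "2 \<le> 2 * rate_const p \<beta> TYPE('b)" by simp
    then show ?thesis using large by (intro mult_right_mono) (auto simp: a_def)
  qed
  also have "\<dots> = lam * (2 * v * lam powr (p - 1) * rate_const p \<beta> TYPE('b))"
  proof -
    have "lam powr p = lam * lam powr (p - 1)"
      using lam powr_add[of lam 1 "p - 1"] by simp
    then show ?thesis by (simp add: a_def)
  qed
  finally show ?thesis using lam by (simp only: mult_le_cancel_left_pos)
qed

lemma uniform_bound: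
  assumes lam: "0 < lam"
  shows "\<exists>A\<in>sets M. 1 - \<delta> \<le> measure M A \<and> (\<forall>\<omega>\<in>A. \<forall>n\<ge>1.
    norm (mu_hat X lam n \<omega> - \<mu>)
      \<le> 2 * v * lam powr (p - 1) * rate_const p \<beta> TYPE('b) + \<beta> * ln (2 / \<delta>) / (lam * real n))"
proof (cases "lam powr p * v \<le> 1")
  case True
  obtain B where B: "B \<in> sets M" "1 - \<delta> \<le> measure M B"
    and le: "\<And>\<omega> n. \<omega> \<in> B \<Longrightarrow> 1 \<le> n \<Longrightarrow> norm (mu_hat X lam n \<omega> - \<mu>)
      \<le> \<beta> / lam * growth p v lam \<beta> TYPE('b) + \<beta> * ln (2 / \<delta>) / (lam * real n)"
    using uniform_bound_small[OF lam True] by blast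
  have "norm (mu_hat X lam n \<omega> - \<mu>)
      \<le> 2 * v * lam powr (p - 1) * rate_const p \<beta> TYPE('b) + \<beta> * ln (2 / \<delta>) / (lam * real n)" if "\<omega> \<in> B" "1 \<le> n" for \<omega> n
    using le[OF that] growth_le[OF lam] by linarith
  then show ?thesis using B by blast
next
  case False
  have nonneg: "0 \<le> \<beta> * ln (2 / \<delta>) / (lam * real n)" for n
    using lam beta_pos ln_pos by simp
  have le: "norm (mu_hat X lam n \<omega> - \<mu>) \<le> 2 * v * lam powr (p - 1) * rate_const p \<beta> TYPE('b)" for \<omega> n
  \<comment> \<open>A nonzero deviation is itself the vector needed for \<beta> \<ge> 1; in the zero
    space only the first case occurs.\<close>
  proof (cases "mu_hat X lam n \<omega> - \<mu> = 0")
    case True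
    then show ?thesis using rate_const_pos v by simp
  next
    case nz: False
    show ?thesis
      using bound_large[OF lam _ beta_ge_1[OF nz]] False by simp
  qed
  have "norm (mu_hat X lam n \<omega> - \<mu>)
      \<le> 2 * v * lam powr (p - 1) * rate_const p \<beta> TYPE('b) + \<beta> * ln (2 / \<delta>) / (lam * real n)" for \<omega> n
    using nonneg[of n] le[of n \<omega>] by linarith
  then show ?thesis
    using \<delta> by (intro bexI[of _ "space M"]) (auto simp: prob_space)
qed

text \<open>With G and L as below the uniform bound is G * lam powr (p - 1) + L / lam. The
  prescribed lam solves lam powr p = L / G, which makes the two terms equal; hence the leading
  factor 2.\<close>

lemma fixed_size_bound:
  assumes n: "1 \<le> n"
    and lam_def: "lam = (ln (2 / \<delta>) * \<beta> / (2 * real n * v * rate_const p \<beta> TYPE('b))) powr (1 / p)"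
  shows "\<exists>A\<in>sets M. 1 - \<delta> \<le> measure M A \<and> (\<forall>\<omega>\<in>A.
    norm (mu_hat X lam n \<omega> - \<mu>)
      \<le> 2 * (2 * v * rate_const p \<beta> TYPE('b)) powr (1 / p) * (\<beta> * ln (2 / \<delta>) / real n) powr ((p - 1) / p))"
proof -
  define G where "G = 2 * v * rate_const p \<beta> TYPE('b)"
  define L where "L = \<beta> * ln (2 / \<delta>) / real n"
  have G: "0 < G" unfolding G_def using v rate_const_pos by (intro mult_pos_pos) auto
  have L: "0 < L" unfolding L_def using n beta_pos ln_pos by simp
  have "ln (2 / \<delta>) * \<beta> / (2 * real n * v * rate_const p \<beta> TYPE('b)) = L / G"
    unfolding L_def G_def by (simp add: mult_ac)
  then have lam: "lam = (L / G) powr (1 / p)" using lam_def by simp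
  have lam_pos: "0 < lam" using lam G L by simp
  have e: "1 - (p - 1) / p = 1 / p" "1 - 1 / p = (p - 1) / p"
    using p by (simp_all add: field_simps)
  have "lam powr (p - 1) = L powr ((p - 1) / p) / G powr ((p - 1) / p)"
    using G L by (simp add: lam powr_powr powr_divide)
  moreover have "G powr (1 - (p - 1) / p) = G / G powr ((p - 1) / p)"
    using G by (subst powr_diff) simp
  ultimately have "G * lam powr (p - 1) = G powr (1 - (p - 1) / p) * L powr ((p - 1) / p)"
    by simp
  moreover have "L / lam = G powr (1 / p) * L powr (1 - 1 / p)"
  proof -
    have "L powr (1 - 1 / p) = L / L powr (1 / p)"
      using L by (subst powr_diff) simp
    then show ?thesis using G L by (simp add: lam powr_divide)
  qed
  ultimately have eq: "G * lam powr (p - 1) + L / lam = 2 * G powr (1 / p) * L powr ((p - 1) / p)"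
    unfolding e by linarith
  have rhs: "2 * v * lam powr (p - 1) * rate_const p \<beta> TYPE('b) + \<beta> * ln (2 / \<delta>) / (lam * real n)
      = 2 * G powr (1 / p) * L powr ((p - 1) / p)"
    unfolding eq[symmetric] by (simp add: G_def L_def mult_ac)
  obtain A where "A \<in> sets M" "1 - \<delta> \<le> measure M A"
    and le: "\<forall>\<omega>\<in>A. \<forall>n\<ge>1. norm (mu_hat X lam n \<omega> - \<mu>)
      \<le> 2 * v * lam powr (p - 1) * rate_const p \<beta> TYPE('b) + \<beta> * ln (2 / \<delta>) / (lam * real n)"
    using uniform_bound[OF lam_pos] by blast
  then show ?thesis
    using n unfolding G_def[symmetric] L_def[symmetric] rhs[symmetric] by blast
qed

end

theorem theorem3:
  fixes M :: "'a measure"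
    and F :: "nat \<Rightarrow> 'a measure"
    and X :: "nat \<Rightarrow> 'a \<Rightarrow> 'b::{banach, second_countable_topology}"
    and \<mu> :: 'b and \<beta> p v \<delta> :: real
  assumes prob: "prob_space M"
    and smooth: "beta_smooth \<beta> TYPE('b)" and beta_pos: "\<beta> > 0"
    and filt_sub: "\<And>n. subalgebra M (F n)"
    and filt_mono: "\<And>i j. i \<le> j \<Longrightarrow> sets (F i) \<subseteq> sets (F j)"
    and adapted: "\<And>n. n \<ge> 1 \<Longrightarrow> X n \<in> borel_measurable (F n)"
    and mean: "\<And>n. n \<ge> 1 \<Longrightarrow> cond_exp_is_const M (F (n - 1)) (X n) \<mu>"
    and moment: "\<And>n. n \<ge> 1 \<Longrightarrow>
        AE \<omega> in M. nn_cond_exp M (F (n - 1)) (\<lambda>\<omega>. ennreal (norm (X n \<omega>) powr p)) \<omega> \<le> ennreal v"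
    and p: "1 < p" "p \<le> 2"
    and v: "v > 0"
    and \<delta>: "0 < \<delta>" "\<delta> \<le> 1"
  shows "(\<forall>lam > 0. \<exists>A \<in> sets M. measure M A \<ge> 1 - \<delta> \<and>
            (\<forall>\<omega> \<in> A. \<forall>n \<ge> 1.
               norm (mu_hat X lam n \<omega> - \<mu>) \<le>
                 2 * v * lam powr (p - 1) * (\<beta> * C_const p \<beta> TYPE('b) + K_const p * 2 powr (p - 1))
                 + \<beta> * ln (2 / \<delta>) / (lam * real n)))
       \<and> (\<forall>n \<ge> 1. let lam = (ln (2 / \<delta>) * \<beta> /
                    (2 * real n * v * (\<beta> * C_const p \<beta> TYPE('b) + K_const p * 2 powr (p - 1)))) powr (1 / p)
              in \<exists>A \<in> sets M. measure M A \<ge> 1 - \<delta> \<and>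
                 (\<forall>\<omega> \<in> A. norm (mu_hat X lam n \<omega> - \<mu>) \<le>
                    2 * (2 * v * (\<beta> * C_const p \<beta> TYPE('b) + K_const p * 2 powr (p - 1))) powr (1 / p)
                      * (\<beta> * ln (2 / \<delta>) / real n) powr ((p - 1) / p)))"
proof -
  interpret heavy_tailed_sequence M F X \<mu> \<beta> p v \<delta>
    by (rule heavy_tailed_sequence.intro[OF prob heavy_tailed_sequence_axioms.intro]) (fact assms)+
  show ?thesis
    unfolding Let_def using uniform_bound fixed_size_bound by blast
qed

end
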